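(* Let $E$ and $F$ be complex Banach spaces, let $U$ be an open subset of $E$, let $p\in[1,\infty)$ and let $f\in\mathcal{H}^\infty(U,F)$. The following conditions are equivalent: (i) $f\colon U\to F$ has relatively $p$-compact range. (ii) There exist a closed subspace $M\subseteq\ell_p$ and operators $R\in\mathcal{QN}_p(F^*,M)$, $S\in\mathcal{L}(M,\mathcal{H}^\infty(U))$ such that $f^t=S\circ R$.
   Context: $\mathcal{L}(X,Y)$ is the Banach space of bounded linear operators between Banach spaces $X,Y$; $B_X$ is the closed unit ball of $X$. $\mathcal{H}^\infty(U,F)$ is the Banach space of all bounded holomorphic mappings $f\colon U\to F$ with the supremum norm, and $\mathcal{H}^\infty(U)=\mathcal{H}^\infty(U,\mathbb{C})$. The transpose of $f\in\mathcal{H}^\infty(U,F)$ is the bounded linear operator $f^t\colon F^*\to\mathcal{H}^\infty(U)$, $f^t(y^* )=y^*\circ f$. For $1<p<\infty$ put $p^*=p/(p-1)$ and, for $(x_n)\in\ell_p(F)$ (absolutely $p$-summable sequences in $F$), $p\text{-}\mathrm{conv}(x_n)=\{\sum_{n=1}^\infty a_nx_n\colon (a_n)\in B_{\ell_{p^*}}\}$; for $p=1$ and $(x_n)\in\ell_1(F)$, $1\text{-}\mathrm{conv}(x_n)=\{\sum_{n=1}^\infty a_nx_n\colon (a_n)\in B_{c_0}\}$. A set $K\subseteq F$ is relatively $p$-compact if $K\subseteq p\text{-}\mathrm{conv}(x_n)$ for some $(x_n)\in\ell_p(F)$. A holomorphic $f\colon U\to F$ has relatively $p$-compact range if $f(U)$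 is relatively $p$-compact in $F$. $\mathcal{QN}_p(X,Y)$ is the set of quasi $p$-nuclear operators: bounded linear $T\colon X\to Y$ for which there is a sequence $(x_n^* )\in\ell_p(X^* )$ such that $\|T(x)\|\le(\sum_{n=1}^\infty|x_n^*(x)|^p)^{1/p}$ for all $x\in X$. *)

theory Defs
  imports "HOL-Analysis.Analysis" "HOL-Library.Function_Algebras"
begin

section \<open>Complex normed spaces\<close>

class scaleC =
  fixes scaleC :: "complex \<Rightarrow> 'a \<Rightarrow> 'a" (infixr "*\<^sub>C" 75)

class complex_vector = scaleC + ab_group_add +
  assumes scaleC_add_right: "a *\<^sub>C (x + y) = a *\<^sub>C x + a *\<^sub>C y"
    and scaleC_add_left: "(a + b) *\<^sub>C x = a *\<^sub>C x + b *\<^sub>C x"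
    and scaleC_scaleC: "a *\<^sub>C b *\<^sub>C x = (a * b) *\<^sub>C x"
    and scaleC_one: "1 *\<^sub>C x = x"

global_interpretation complex_vector: vector_space "scaleC :: complex \<Rightarrow> 'a \<Rightarrow> 'a::complex_vector"
  by unfold_locales (auto simp: scaleC_add_right scaleC_add_left scaleC_scaleC scaleC_one)

class complex_normed_vector = complex_vector + real_normed_vector +
  assumes scaleR_scaleC: "r *\<^sub>R x = complex_of_real r *\<^sub>C x"
    and norm_scaleC: "norm (c *\<^sub>C x) = cmod c * norm x"

class complex_banach = complex_normed_vector + complete_space

instantiation complex :: complex_banach
begin

definition scaleC_complex :: "complex \<Rightarrow> complex \<Rightarrow> complex" where
  "scaleC_complex c z = c * z"

instance
  by standard (auto simp: scaleC_complex_def algebra_simps norm_mult scaleR_conv_of_real)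

end

instantiation "fun" :: (type, complex_vector) complex_vector
begin

definition scaleC_fun :: "complex \<Rightarrow> ('a \<Rightarrow> 'b) \<Rightarrow> 'a \<Rightarrow> 'b" where
  "scaleC_fun c f = (\<lambda>x. c *\<^sub>C f x)"

instance
  by standard
    (auto simp: scaleC_fun_def fun_eq_iff scaleC_add_right scaleC_add_left scaleC_scaleC scaleC_one)

end


section \<open>The dual space\<close>

typedef (overloaded) 'a cdual =
  "{\<phi> :: 'a::complex_normed_vector \<Rightarrow> complex.
      bounded_linear \<phi> \<and> (\<forall>c x. \<phi> (c *\<^sub>C x) = c * \<phi> x)}"
  morphisms cdual_apply Cdual
  by (rule exI[of _ "\<lambda>x. 0"]) auto

setup_lifting type_definition_cdual

instantiation cdual :: (complex_normed_vector) complex_normed_vector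
begin

lift_definition norm_cdual :: "'a cdual \<Rightarrow> real" is onorm .

lift_definition minus_cdual :: "'a cdual \<Rightarrow> 'a cdual \<Rightarrow> 'a cdual" is "\<lambda>f g x. f x - g x"
  by (auto intro: bounded_linear_sub simp: algebra_simps)

lift_definition plus_cdual :: "'a cdual \<Rightarrow> 'a cdual \<Rightarrow> 'a cdual" is "\<lambda>f g x. f x + g x"
  by (auto intro: bounded_linear_add simp: algebra_simps)

lift_definition uminus_cdual :: "'a cdual \<Rightarrow> 'a cdual" is "\<lambda>f x. - f x"
  by (auto intro: bounded_linear_minus)

lift_definition zero_cdual :: "'a cdual" is "\<lambda>x. 0"
  by auto

lift_definition scaleC_cdual :: "complex \<Rightarrow> 'a cdual \<Rightarrow> 'a cdual" is "\<lambda>c f x. c * f x"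
  by (auto intro: bounded_linear_const_mult)

lift_definition scaleR_cdual :: "real \<Rightarrow> 'a cdual \<Rightarrow> 'a cdual" is "\<lambda>r f x. r *\<^sub>R f x"
  by (auto intro: bounded_linear_const_scaleR)

definition dist_cdual :: "'a cdual \<Rightarrow> 'a cdual \<Rightarrow> real" where
  "dist_cdual f g = norm (f - g)"

definition uniformity_cdual :: "('a cdual \<times> 'a cdual) filter" where
  "uniformity_cdual = (INF e\<in>{0<..}. principal {(x, y). dist x y < e})"

definition open_cdual :: "'a cdual set \<Rightarrow> bool" where
  "open_cdual S = (\<forall>x\<in>S. \<forall>\<^sub>F (x', y) in uniformity. x' = x \<longrightarrow> y \<in> S)"

definition sgn_cdual :: "'a cdual \<Rightarrow> 'a cdual" where
  "sgn_cdual f = inverse (norm f) *\<^sub>R f"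

instance
proof
  fix a b :: complex and r s :: real and f g h :: "'a cdual" and S :: "'a cdual set"
  show "f + g + h = f + (g + h)" by transfer auto
  show "f + g = g + f" by transfer auto
  show "0 + f = f" by transfer auto
  show "- f + f = 0" by transfer auto
  show "f - g = f + - g" by transfer auto
  show "a *\<^sub>C (f + g) = a *\<^sub>C f + a *\<^sub>C g" by transfer (auto simp: algebra_simps)
  show "(a + b) *\<^sub>C f = a *\<^sub>C f + b *\<^sub>C f" by transfer (auto simp: algebra_simps)
  show "a *\<^sub>C b *\<^sub>C f = (a * b) *\<^sub>C f" by transfer (auto simp: algebra_simps)
  show "1 *\<^sub>C f = f" by transfer auto
  show "r *\<^sub>R (f + g) = r *\<^sub>R f + r *\<^sub>R g" by transfer (auto simp: algebra_simps)
  show "(r + s) *\<^sub>R f = r *\<^sub>R f + s *\<^sub>R f" by transfer (auto simp: algebra_simps)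
  show "r *\<^sub>R s *\<^sub>R f = (r * s) *\<^sub>R f" by transfer (auto simp: algebra_simps)
  show "1 *\<^sub>R f = f" by transfer auto
  show "r *\<^sub>R f = complex_of_real r *\<^sub>C f" by transfer (auto simp: scaleR_conv_of_real)
  show "dist f g = norm (f - g)" by (rule dist_cdual_def)
  show "sgn f = inverse (norm f) *\<^sub>R f" by (rule sgn_cdual_def)
  show "(uniformity :: ('a cdual \<times> 'a cdual) filter) =
      (INF e\<in>{0<..}. principal {(x, y). dist x y < e})"
    by (rule uniformity_cdual_def)
  show "open S = (\<forall>x\<in>S. \<forall>\<^sub>F (x', y) in uniformity. x' = x \<longrightarrow> y \<in> S)"
    by (rule open_cdual_def)
  show "norm f = 0 \<longleftrightarrow> f = 0" by transfer (auto simp: onorm_eq_0 fun_eq_iff)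
  show "norm (f + g) \<le> norm f + norm g" by transfer (auto intro: onorm_triangle)
  show "norm (r *\<^sub>R f) = \<bar>r\<bar> * norm f" by transfer (auto simp: onorm_scaleR)
  show "norm (a *\<^sub>C f) = cmod a * norm f"
  proof transfer
    fix a :: complex and f :: "'a \<Rightarrow> complex"
    assume "bounded_linear f \<and> (\<forall>c x. f (c *\<^sub>C x) = c * f x)"
    then have f: "bounded_linear f" by simp
    have "onorm (\<lambda>x. a * f x) = onorm (\<lambda>x. cmod a *\<^sub>R f x)"
      by (simp add: onorm_def norm_mult)
    then show "onorm (\<lambda>x. a * f x) = cmod a * onorm f"
      by (simp add: onorm_scaleR[OF f])
  qed
qed

end


section \<open>Sequence spaces\<close>

definition lp :: "real \<Rightarrow> (nat \<Rightarrow> 'a::real_normed_vector) set" where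
  "lp p = {x. summable (\<lambda>n. norm (x n) powr p)}"

definition lp_norm :: "real \<Rightarrow> (nat \<Rightarrow> 'a::real_normed_vector) \<Rightarrow> real" where
  "lp_norm p x = (\<Sum>n. norm (x n) powr p) powr (1 / p)"

definition lp_topology :: "real \<Rightarrow> (nat \<Rightarrow> 'a::real_normed_vector) topology" where
  "lp_topology p = Metric_space.mtopology (lp p) (\<lambda>x y. lp_norm p (x - y))"

lemma powr_convex_combination:
  fixes t u v p :: real
  assumes "p \<ge> 1" "0 \<le> t" "t \<le> 1" "0 \<le> u" "0 \<le> v"
  shows "((1 - t) * u + t * v) powr p \<le> (1 - t) * u powr p + t * v powr p"
proof -
  have *: "s powr p \<le> s" if "0 \<le> s" "s \<le> 1" for s :: real
    using powr_mono'[of 1 p s] that assms(1) by (cases "s = 0") auto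
  consider "u = 0" | "v = 0" | "u > 0" "v > 0"
    using assms by linarith
  then show ?thesis
  proof cases
    case 1
    then show ?thesis
      using assms mult_right_mono[OF *[of t], of "v powr p"] by (simp add: powr_mult)
  next
    case 2
    then show ?thesis
      using assms mult_right_mono[OF *[of "1 - t"], of "u powr p"] by (simp add: powr_mult)
  next
    case 3
    then show ?thesis
      using convex_onD[OF powr_convex[OF assms(1)], of t u v] assms by simp
  qed
qed

lemma lp_norm_nonneg: "0 \<le> lp_norm p x"
  by (simp add: lp_norm_def)

lemma lp_norm_powr:
  assumes "p \<ge> 1" "x \<in> lp p"
  shows "lp_norm p x powr p = (\<Sum>n. norm (x n) powr p)"
  using assms suminf_nonneg[of "\<lambda>n. norm (x n) powr p"]
  by (simp add: lp_norm_def lp_def powr_powr)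

lemma lp_norm_eq_0_iff:
  assumes "p \<ge> 1" "x \<in> lp p"
  shows "lp_norm p x = 0 \<longleftrightarrow> x = 0"
proof -
  have "lp_norm p x = 0 \<longleftrightarrow> (\<Sum>n. norm (x n) powr p) = 0"
    by (simp add: lp_norm_def)
  also have "\<dots> \<longleftrightarrow> (\<forall>n. norm (x n) powr p = 0)"
    using assms by (intro suminf_eq_zero_iff) (auto simp: lp_def)
  finally show ?thesis by (simp add: fun_eq_iff)
qed

lemma minkowski_lp:
  fixes x y :: "nat \<Rightarrow> 'a::real_normed_vector"
  assumes p: "p \<ge> 1" and x: "x \<in> lp p" and y: "y \<in> lp p"
  shows "x + y \<in> lp p" "lp_norm p (x + y) \<le> lp_norm p x + lp_norm p y"
proof -
  have "x + y \<in> lp p \<and> lp_norm p (x + y) \<le> lp_norm p x + lp_norm p y"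
  proof (cases "x = 0 \<or> y = 0")
    case True
    then show ?thesis using x y lp_norm_nonneg by auto
  next
    case False
    define A B where "A = lp_norm p x" and "B = lp_norm p y"
    have pos: "A > 0" "B > 0"
      using False lp_norm_eq_0_iff p x y lp_norm_nonneg
      unfolding A_def B_def by (metis order_less_le)+
    define t where "t = B / (A + B)"
    have t: "0 \<le> t" "t \<le> 1" "1 - t = A / (A + B)"
      using pos by (auto simp: t_def field_simps)
    define b where "b = (\<lambda>n. (A + B) powr p *
      ((1 - t) * (norm (x n) powr p / A powr p) + t * (norm (y n) powr p / B powr p)))"
    have le: "norm ((x + y) n) powr p \<le> b n" for n
    proof -
      have "norm ((x + y) n) powr p \<le> (norm (x n) + norm (y n)) powr p"
        using p by (auto intro: powr_mono2 norm_triangle_ineq)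
      also have "norm (x n) + norm (y n) =
          (A + B) * ((1 - t) * (norm (x n) / A) + t * (norm (y n) / B))"
      proof -
        have "(A + B) * (1 - t) = A" "(A + B) * t = B"
          using pos unfolding t(3) by (auto simp: t_def)
        then have "(A + B) * ((1 - t) * u + t * v) = A * u + B * v" for u v
          by (metis distrib_left mult.assoc)
        from this[of "norm (x n) / A" "norm (y n) / B"] show ?thesis
          using pos by simp
      qed
      also have "\<dots> powr p =
          (A + B) powr p * ((1 - t) * (norm (x n) / A) + t * (norm (y n) / B)) powr p"
        by (rule powr_mult)
      also have "\<dots> \<le> (A + B) powr p *
          ((1 - t) * (norm (x n) / A) powr p + t * (norm (y n) / B) powr p)"
        using pos t p by (intro mult_left_mono powr_convex_combination) auto
      also have "\<dots> = b n"
        using pos by (simp add: b_def powr_divide)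
      finally show ?thesis .
    qed
    have sx: "(\<lambda>n. norm (x n) powr p) sums (A powr p)"
      and sy: "(\<lambda>n. norm (y n) powr p) sums (B powr p)"
      using x y lp_norm_powr[OF p x] lp_norm_powr[OF p y] by (simp_all add: A_def B_def lp_def sums_iff)
    have b: "b sums ((A + B) powr p *
        ((1 - t) * (A powr p / A powr p) + t * (B powr p / B powr p)))"
      unfolding b_def by (intro sums_mult sums_add sums_divide sx sy)
    then have b: "b sums ((A + B) powr p)" using pos by simp
    have mem: "summable (\<lambda>n. norm ((x + y) n) powr p)"
      by (rule summable_comparison_test'[of b 0]) (use b le in \<open>auto simp: sums_iff\<close>)
    have "lp_norm p (x + y) \<le> ((A + B) powr p) powr (1 / p)"
      unfolding lp_norm_def
    proof (rule powr_mono2)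
      show "(\<Sum>n. norm ((x + y) n) powr p) \<le> (A + B) powr p"
        using suminf_le[OF le mem] b by (simp add: sums_iff)
    qed (use p mem in \<open>auto intro: suminf_nonneg\<close>)
    also have "\<dots> = A + B" using pos p by (simp add: powr_powr)
    finally show ?thesis using mem by (simp add: lp_def A_def B_def)
  qed
  then show "x + y \<in> lp p" "lp_norm p (x + y) \<le> lp_norm p x + lp_norm p y"
    by auto
qed

lemma Metric_space_lp:
  assumes p: "p \<ge> 1"
  shows "Metric_space (lp p :: (nat \<Rightarrow> 'a::real_normed_vector) set) (\<lambda>x y. lp_norm p (x - y))"
proof
  have uminus: "- x \<in> lp p" if "x \<in> lp p" for x :: "nat \<Rightarrow> 'a"
    using that by (simp add: lp_def)
  have diff: "x - y \<in> lp p" if "x \<in> lp p" "y \<in> lp p" for x y :: "nat \<Rightarrow> 'a"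
    using minkowski_lp(1)[OF p that(1) uminus[OF that(2)]] by simp
  fix x y z :: "nat \<Rightarrow> 'a"
  show "0 \<le> lp_norm p (x - y)" by (rule lp_norm_nonneg)
  show "lp_norm p (x - y) = lp_norm p (y - x)"
    by (simp add: lp_norm_def norm_minus_commute)
  assume xy: "x \<in> lp p" "y \<in> lp p"
  show "lp_norm p (x - y) = 0 \<longleftrightarrow> x = y"
    using lp_norm_eq_0_iff[OF p diff[OF xy]] by simp
  assume z: "z \<in> lp p"
  show "lp_norm p (x - z) \<le> lp_norm p (x - y) + lp_norm p (y - z)"
    using minkowski_lp(2)[OF p diff[OF xy] diff[OF xy(2) z]] by simp
qed


section \<open>Relatively \<open>p\<close>-compact sets\<close>

text \<open>The closed unit ball of \<open>\<ell>\<^sub>q\<close> with \<open>q = p / (p - 1)\<close>, replaced by that of \<open>c\<^sub>0\<close>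
  (not of \<open>\<ell>\<^sub>\<infinity>\<close>) when \<open>p = 1\<close>.\<close>

definition coeff_ball :: "real \<Rightarrow> (nat \<Rightarrow> complex) set" where
  "coeff_ball p =
     (if p = 1 then {a. a \<longlonglongrightarrow> 0 \<and> (\<forall>n. cmod (a n) \<le> 1)}
      else {a \<in> lp (p / (p - 1)). lp_norm (p / (p - 1)) a \<le> 1})"

definition p_conv :: "real \<Rightarrow> (nat \<Rightarrow> 'a::complex_normed_vector) \<Rightarrow> 'a set" where
  "p_conv p x = {s. \<exists>a\<in>coeff_ball p. (\<lambda>n. a n *\<^sub>C x n) sums s}"

definition relatively_p_compact :: "real \<Rightarrow> 'a::complex_normed_vector set \<Rightarrow> bool" where
  "relatively_p_compact p K \<longleftrightarrow> (\<exists>x\<in>lp p. K \<subseteq> p_conv p x)"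


section \<open>Bounded holomorphic mappings\<close>

definition cholomorphic_on ::
  "('a::complex_normed_vector \<Rightarrow> 'b::complex_normed_vector) \<Rightarrow> 'a set \<Rightarrow> bool" where
  "cholomorphic_on f U \<longleftrightarrow>
     (\<forall>x\<in>U. \<exists>D. (f has_derivative D) (at x within U) \<and> (\<forall>c h. D (c *\<^sub>C h) = c *\<^sub>C D h))"

text \<open>A mapping on \<open>U\<close> is represented by its extension by zero, so that \<open>Hinf U\<close> is a vector
  space under the pointwise operations and a mapping is determined by its values on \<open>U\<close>.\<close>

definition Hinf :: "'a set \<Rightarrow> ('a::complex_normed_vector \<Rightarrow> 'b::complex_normed_vector) set" where
  "Hinf U = {f. cholomorphic_on f U \<and> bounded (f ` U) \<and> (\<forall>x. x \<notin> U \<longrightarrow> f x = 0)}"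

text \<open>The inserted \<open>0\<close> matters only for \<open>U = {}\<close>, where \<open>Hinf U\<close> is the zero space.\<close>

definition Hinf_norm :: "'a set \<Rightarrow> ('a \<Rightarrow> 'b::real_normed_vector) \<Rightarrow> real" where
  "Hinf_norm U f = Sup (insert 0 ((\<lambda>x. norm (f x)) ` U))"

text \<open>For \<open>f \<in> Hinf U\<close> the composition again vanishes off \<open>U\<close>, since functionals map \<open>0\<close> to \<open>0\<close>.\<close>

definition holo_transpose ::
  "('a \<Rightarrow> 'b::complex_normed_vector) \<Rightarrow> 'b cdual \<Rightarrow> 'a \<Rightarrow> complex" where
  "holo_transpose f \<phi> = cdual_apply \<phi> \<circ> f"


section \<open>Operators\<close>

text \<open>Bounded linear operators from \<open>V\<close>, normed by \<open>nV\<close>, to \<open>W\<close>, normed by \<open>nW\<close>. The values of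
  an operator off \<open>V\<close> are irrelevant.\<close>

definition bounded_ops ::
  "'a::complex_vector set \<Rightarrow> ('a \<Rightarrow> real) \<Rightarrow> 'b::complex_vector set \<Rightarrow> ('b \<Rightarrow> real) \<Rightarrow> ('a \<Rightarrow> 'b) set"
where
  "bounded_ops V nV W nW =
     {T. T ` V \<subseteq> W \<and>
         (\<forall>x\<in>V. \<forall>y\<in>V. T (x + y) = T x + T y) \<and>
         (\<forall>c. \<forall>x\<in>V. T (c *\<^sub>C x) = c *\<^sub>C T x) \<and>
         (\<exists>K. \<forall>x\<in>V. nW (T x) \<le> K * nV x)}"

definition quasi_p_nuclear_ops ::
  "real \<Rightarrow> 'b::complex_vector set \<Rightarrow> ('b \<Rightarrow> real) \<Rightarrow> ('a::complex_normed_vector \<Rightarrow> 'b) set"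
where
  "quasi_p_nuclear_ops p W nW =
     {T \<in> bounded_ops UNIV norm W nW.
        \<exists>\<phi>\<in>lp p. \<forall>x. nW (T x) \<le> (\<Sum>n. cmod (cdual_apply (\<phi> n) x) powr p) powr (1 / p)}"

end

theory Submission
  imports Defs "HOL-Complex_Analysis.Cauchy_Integral_Formula"
begin

text \<open>
  Let \<open>K\<close> be the range of \<open>f\<close>. Both conditions say that \<open>K\<close> is controlled by a \<open>p\<close>-summable
  sequence: compactness of \<open>K\<close> by a sequence in \<open>F\<close>, and the factorization, once unwound, by a sequence
  \<open>\<phi>\<close> in the bidual of \<open>F\<close>, since it yields \<open>|y(x)| \<le> C \<parallel>(\<phi>\<^sub>n(y))\<^sub>n\<parallel>\<^sub>p\<close> for all \<open>x \<in> K\<close> and all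
  functionals \<open>y\<close>.

  If \<open>K\<close> lies in the \<open>p\<close>-convex hull of \<open>(x\<^sub>n)\<close>, choose coefficients \<open>a u\<close> with
  \<open>f u = \<Sum> a u n x\<^sub>n\<close>. The operators are \<open>R y = (y(x\<^sub>n))\<^sub>n\<close> and \<open>S m u = \<Sum> a u n m\<^sub>n\<close>, and \<open>M\<close> consists of
  those \<open>m \<in> \<ell>\<^sub>p\<close> for which \<open>S m\<close> is holomorphic. It is closed because uniform limits of holomorphic
  functions are holomorphic (\<open>transpose_factors_if_p_compact_range\<close>).

  The converse has to bring the controlling sequence from the bidual back to \<open>F\<close>. Extending
  \<open>(\<phi>\<^sub>n(y))\<^sub>n \<mapsto> y(x)\<close> to \<open>\<ell>\<^sub>p\<close> represents every \<open>x \<in> K\<close> as \<open>\<Sum> b\<^sub>n \<phi>\<^sub>n\<close> with \<open>b\<close> in the dual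
  ball of \<open>\<ell>\<^sub>p\<close> (\<open>bidual_hull_if_dominated\<close>). Let \<open>D(\<phi>)\<close> be the set of all points of \<open>F\<close> that have such a
  representation. The leading coefficients are totally bounded and the tail of \<open>\<phi>\<close> is small, so \<open>D(\<phi>)\<close>
  is contained in \<open>A + D(\<phi>')\<close> with \<open>A \<subseteq> D(\<phi>)\<close> finite and \<open>\<phi>'\<close> as small as desired
  (\<open>bidual_hull_finite_cover\<close>). On the finite set \<open>A\<close> the vectors \<open>\<phi>\<^sub>n\<close> may be replaced by vectors
  \<open>z\<^sub>n \<in> F\<close> of comparable norm; this is Helly's theorem, that is, Hahn--Banach separation in a finite
  power of \<open>F\<close> (\<open>helly_approximation\<close>). Iterating with hulls of norm at most a constant times \<open>4\<^bsup>-k\<^esup>\<close>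
  writes every point of \<open>D(\<phi>)\<close> as a series of blocks of combinations of vectors in \<open>F\<close>. Shifting a factor
  \<open>2\<^bsup>k+1\<^esup>\<close> from the coefficients of block \<open>k\<close> to its vectors makes the concatenated coefficients an
  element of the dual ball that tends to zero, and leaves the vectors \<open>p\<close>-summable
  (\<open>dual_ball_series_of_blocks\<close>).
\<close>

section \<open>The Hahn--Banach theorem for complex seminorms\<close>

text \<open>The functionals live on a subspace \<open>V\<close> because \<open>\<ell>\<^sub>p\<close> is a set of sequences and not a type.
  Zorn's lemma is applied to graphs: a linear subspace of \<open>V \<times> \<real>\<close> lying below the graph of \<open>q\<close> is
  automatically single-valued, since \<open>q 0 = 0\<close>, and unions of chains of such subspaces are again of
  this kind.\<close>
lemma hahn_banach_sublinear:
  fixes q :: "'v::complex_vector \<Rightarrow> real" and l :: "'v \<Rightarrow> real"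
  assumes V: "complex_vector.subspace V" and W: "complex_vector.subspace W" "W \<subseteq> V"
    and q_add: "\<And>x y. x \<in> V \<Longrightarrow> y \<in> V \<Longrightarrow> q (x + y) \<le> q x + q y"
    and q_scale: "\<And>r x. 0 \<le> r \<Longrightarrow> x \<in> V \<Longrightarrow> q (complex_of_real r *\<^sub>C x) = r * q x"
    and l_add: "\<And>x y. x \<in> W \<Longrightarrow> y \<in> W \<Longrightarrow> l (x + y) = l x + l y"
    and l_scale: "\<And>r x. x \<in> W \<Longrightarrow> l (complex_of_real r *\<^sub>C x) = r * l x"
    and l_le: "\<And>x. x \<in> W \<Longrightarrow> l x \<le> q x"
  obtains g where "\<And>x y. x \<in> V \<Longrightarrow> y \<in> V \<Longrightarrow> g (x + y) = g x + g y"
    and "\<And>r x. x \<in> V \<Longrightarrow> g (complex_of_real r *\<^sub>C x) = r * g x"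
    and "\<And>x. x \<in> W \<Longrightarrow> g x = l x" and "\<And>x. x \<in> V \<Longrightarrow> g x \<le> q x"
proof -
  let ?s = "\<lambda>r x. complex_of_real r *\<^sub>C (x::'v)"
  note [simp] = complex_vector.subspace_add[OF V] complex_vector.subspace_scale[OF V]
    complex_vector.subspace_diff[OF V] complex_vector.subspace_neg[OF V]
  define lin where "lin = (\<lambda>G. \<forall>x s y t r. (x, s) \<in> G \<longrightarrow> (y, t) \<in> G \<longrightarrow> (x + ?s r y, s + r * t) \<in> G)"
  define GG where "GG = {G. (\<lambda>w. (w, l w)) ` W \<subseteq> G \<and> fst ` G \<subseteq> V \<and> lin G \<and> (\<forall>(x, s) \<in> G. s \<le> q x)}"
  have "\<exists>M\<in>GG. \<forall>X\<in>GG. M \<subseteq> X \<longrightarrow> X = M"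
  proof (rule subset_Zorn_nonempty)
    have "lin ((\<lambda>w. (w, l w)) ` W)"
      using W by (auto simp: lin_def image_iff l_add l_scale complex_vector.subspace_add complex_vector.subspace_scale)
    then show "GG \<noteq> {}"
      using W l_le by (auto simp: GG_def intro!: exI[of _ "(\<lambda>w. (w, l w)) ` W"])
  next
    fix C assume C: "C \<noteq> {}" "subset.chain GG C"
    have CG: "G \<in> GG" if "G \<in> C" for G
      using C that by (auto simp: subset_chain_def)
    have "lin (\<Union>C)"
      unfolding lin_def
    proof (intro allI impI)
      fix x s y t r assume "(x, s) \<in> \<Union>C" "(y, t) \<in> \<Union>C"
      then obtain G H where GH: "G \<in> C" "H \<in> C" "(x, s) \<in> G" "(y, t) \<in> H" by auto
      then obtain K where "K \<in> C" "(x, s) \<in> K" "(y, t) \<in> K"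
        using C(2) unfolding subset_chain_def by (metis subsetD)
      moreover have "lin K" using CG[OF \<open>K \<in> C\<close>] by (simp add: GG_def)
      ultimately show "(x + ?s r y, s + r * t) \<in> \<Union>C" unfolding lin_def by blast
    qed
    moreover have "(\<lambda>w. (w, l w)) ` W \<subseteq> \<Union>C"
      using C(1) CG unfolding GG_def by blast
    moreover have "fst ` \<Union>C \<subseteq> V" "\<forall>(x, s) \<in> \<Union>C. s \<le> q x"
      using CG unfolding GG_def by blast+
    ultimately show "\<Union>C \<in> GG" by (simp add: GG_def)
  qed
  then obtain M where M: "M \<in> GG" and max: "\<And>X. X \<in> GG \<Longrightarrow> M \<subseteq> X \<Longrightarrow> X = M" by blast
  have Ml: "\<And>w. w \<in> W \<Longrightarrow> (w, l w) \<in> M" and MV: "\<And>x s. (x, s) \<in> M \<Longrightarrow> x \<in> V"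
    and Mq: "\<And>x s. (x, s) \<in> M \<Longrightarrow> s \<le> q x"
    and Mlin: "\<And>x s y t r. (x, s) \<in> M \<Longrightarrow> (y, t) \<in> M \<Longrightarrow> (x + ?s r y, s + r * t) \<in> M"
    using M unfolding GG_def lin_def by fastforce+
  have M0: "(0, 0) \<in> M"
    using Ml[of 0] l_scale[of 0 0] W(1) complex_vector.subspace_0 by auto
  have Madd: "(x + y, s + t) \<in> M" if "(x, s) \<in> M" "(y, t) \<in> M" for x y s t
    using Mlin[OF that, of 1] by (simp add: scaleC_one)
  have Mscale: "(?s r x, r * s) \<in> M" if "(x, s) \<in> M" for x s r
    using Mlin[OF M0 that, of r] by simp
  have q0: "q 0 = 0" using q_scale[of 0 0] complex_vector.subspace_0[OF V] by simp
  have total: "\<exists>c. (x0, c) \<in> M" if x0: "x0 \<in> V" for x0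
  proof -
    have key: "s - q (w - x0) \<le> q (w' + x0) - s'" if "(w, s) \<in> M" "(w', s') \<in> M" for w s w' s'
    proof -
      have "s + s' \<le> q (w + w')" using Mq Madd that by blast
      also have "\<dots> = q ((w - x0) + (w' + x0))" by (simp add: algebra_simps)
      also have "\<dots> \<le> q (w - x0) + q (w' + x0)" using MV that x0 by (intro q_add) auto
      finally show ?thesis by simp
    qed
    define T where "T = (\<lambda>(w, s). s - q (w - x0)) ` M"
    \<comment> \<open>any value between the two sides of \<open>key\<close> extends the functional to \<open>x0\<close>\<close>
    define c where "c = Sup T"
    have bdd: "bdd_above T"
      unfolding T_def by (rule bdd_aboveI2[where M = "q (0 + x0) - 0"]) (use key M0 in force)
    have up: "s - q (w - x0) \<le> c" if "(w, s) \<in> M" for w s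
      unfolding c_def by (rule cSup_upper[OF _ bdd]) (use that in \<open>force simp: T_def\<close>)
    have lo: "c \<le> q (w + x0) - s" if "(w, s) \<in> M" for w s
      unfolding c_def by (rule cSup_least) (use that key M0 in \<open>auto simp: T_def\<close>)
    define M' where "M' = {(w + ?s r x0, s + r * c) | w s r. (w, s) \<in> M}"
    have "M \<subseteq> M'"
    proof clarify
      fix w s assume "(w, s) \<in> M"
      moreover have "(w, s) = (w + ?s 0 x0, s + 0 * c)" by simp
      ultimately show "(w, s) \<in> M'" unfolding M'_def by blast
    qed
    moreover have "M' \<in> GG"
      unfolding GG_def
    proof (intro CollectI conjI)
      show "(\<lambda>w. (w, l w)) ` W \<subseteq> M'" using Ml \<open>M \<subseteq> M'\<close> by auto
      show "fst ` M' \<subseteq> V" using MV x0 by (auto simp: M'_def)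
      show "lin M'"
        unfolding lin_def
      proof (intro allI impI)
        fix x s y t r assume "(x, s) \<in> M'" "(y, t) \<in> M'"
        then obtain w a h w' a' h' where *: "(w, a) \<in> M" "(w', a') \<in> M"
          "x = w + ?s h x0" "s = a + h * c" "y = w' + ?s h' x0" "t = a' + h' * c"
          unfolding M'_def by blast
        have "x + ?s r y = (w + ?s r w') + ?s (h + r * h') x0" "s + r * t = (a + r * a') + (h + r * h') * c"
          by (simp_all add: * algebra_simps scaleC_add_left scaleC_add_right scaleC_scaleC)
        then show "(x + ?s r y, s + r * t) \<in> M'"
          unfolding M'_def using Mlin[OF *(1,2)] by blast
      qed
      have "s + r * c \<le> q (w + ?s r x0)" if ws: "(w, s) \<in> M" for w s r
      proof -
        consider "r = 0" | "r > 0" | "r < 0" by linarith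
        then show ?thesis
        proof cases
          case 1 then show ?thesis using Mq[OF ws] by simp
        next
          case 2
          have "c \<le> q (?s (1 / r) w + x0) - 1 / r * s" by (rule lo[OF Mscale[OF ws]])
          then have "r * c \<le> r * q (?s (1 / r) w + x0) - s"
            using 2 by (simp add: field_simps)
          also have "r * q (?s (1 / r) w + x0) = q (?s r (?s (1 / r) w + x0))"
            using 2 MV[OF ws] x0 by (intro q_scale[symmetric]) auto
          also have "?s r (?s (1 / r) w + x0) = w + ?s r x0"
            using 2 by (simp add: scaleC_add_right scaleC_scaleC scaleC_one flip: of_real_mult)
          finally show ?thesis by simp
        next
          case 3
          have "1 / (- r) * s - q (?s (1 / (- r)) w - x0) \<le> c" by (rule up[OF Mscale[OF ws]])
          then have "s - (- r) * q (?s (1 / (- r)) w - x0) \<le> (- r) * c"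
            using 3 by (simp add: field_simps)
          also have "(- r) * q (?s (1 / (- r)) w - x0) = q (?s (- r) (?s (1 / (- r)) w - x0))"
            using 3 MV[OF ws] x0 by (intro q_scale[symmetric]) auto
          also have "?s (- r) (?s (1 / (- r)) w - x0) = w + ?s r x0"
            using 3 by (simp add: complex_vector.scale_right_diff_distrib scaleC_scaleC scaleC_one 
              complex_vector.scale_minus_left del: of_real_minus of_real_divide flip: of_real_mult)
             (simp add: complex_vector.scale_minus_left)
          finally show ?thesis by simp
        qed
      qed
      then show "\<forall>(x, s)\<in>M'. s \<le> q x" by (auto simp: M'_def)
    qed
    ultimately have "M' = M" by (intro max) auto
    moreover have "(0 + ?s 1 x0, 0 + 1 * c) \<in> M'" unfolding M'_def using M0 by blast
    ultimately show ?thesis by (auto simp: scaleC_one)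
  qed
  have uniq: "s = t" if "(x, s) \<in> M" "(x, t) \<in> M" for x s t
  proof -
    have "(0, s - t) \<in> M" "(0, t - s) \<in> M"
      using Mlin[OF that, of "-1"] Mlin[OF that(2,1), of "-1"]
      by (auto simp: scaleC_one complex_vector.scale_minus_left)
    from this[THEN Mq] show ?thesis using q0 by simp
  qed
  define g where "g = (\<lambda>x. THE s. (x, s) \<in> M)"
  have g_eq: "g x = s" if "(x, s) \<in> M" for x s
    unfolding g_def using that uniq by blast
  have g: "(x, g x) \<in> M" if "x \<in> V" for x
    using total[OF that] g_eq by auto
  show thesis
  proof (rule that)
    show "g (x + y) = g x + g y" if "x \<in> V" "y \<in> V" for x y
      by (rule g_eq) (rule Madd[OF g g, OF that])
    show "g (?s r x) = r * g x" if "x \<in> V" for r x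
      by (rule g_eq) (rule Mscale[OF g, OF that])
    show "g x = l x" if "x \<in> W" for x
      by (rule g_eq) (rule Ml[OF that])
    show "g x \<le> q x" if "x \<in> V" for x
      by (rule Mq) (rule g[OF that])
  qed
qed

text \<open>The real part of a complex functional determines it through \<open>L x = g x - \<i> g (\<i> x)\<close>, so it suffices
  to extend the real part of \<open>l\<close>.\<close>
lemma hahn_banach_seminorm:
  fixes q :: "'v::complex_vector \<Rightarrow> real" and l :: "'v \<Rightarrow> complex"
  assumes V: "complex_vector.subspace V" and W: "complex_vector.subspace W" "W \<subseteq> V"
    and q_add: "\<And>x y. x \<in> V \<Longrightarrow> y \<in> V \<Longrightarrow> q (x + y) \<le> q x + q y"
    and q_scale: "\<And>c x. x \<in> V \<Longrightarrow> q (c *\<^sub>C x) = cmod c * q x"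
    and l_add: "\<And>x y. x \<in> W \<Longrightarrow> y \<in> W \<Longrightarrow> l (x + y) = l x + l y"
    and l_scale: "\<And>c x. x \<in> W \<Longrightarrow> l (c *\<^sub>C x) = c * l x"
    and l_le: "\<And>x. x \<in> W \<Longrightarrow> cmod (l x) \<le> q x"
  obtains L where "\<And>x y. x \<in> V \<Longrightarrow> y \<in> V \<Longrightarrow> L (x + y) = L x + L y"
    and "\<And>c x. x \<in> V \<Longrightarrow> L (c *\<^sub>C x) = c * L x"
    and "\<And>x. x \<in> W \<Longrightarrow> L x = l x" and "\<And>x. x \<in> V \<Longrightarrow> cmod (L x) \<le> q x"
proof -
  obtain g where g_add: "\<And>x y. x \<in> V \<Longrightarrow> y \<in> V \<Longrightarrow> g (x + y) = g x + g y"
    and g_scale: "\<And>r x. x \<in> V \<Longrightarrow> g (complex_of_real r *\<^sub>C x) = r * g x"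
    and gl: "\<And>x. x \<in> W \<Longrightarrow> g x = Re (l x)" and gq: "\<And>x. x \<in> V \<Longrightarrow> g x \<le> q x"
  proof (rule hahn_banach_sublinear[OF V W, of q "\<lambda>x. Re (l x)"])
    show "Re (l x) \<le> q x" if "x \<in> W" for x
      using l_le[OF that] complex_Re_le_cmod order_trans by blast
  qed (use q_add q_scale l_add l_scale in auto)
  note [simp] = complex_vector.subspace_add[OF V] complex_vector.subspace_scale[OF V]
    complex_vector.subspace_neg[OF V]
  define L where "L = (\<lambda>x. Complex (g x) (- g (\<i> *\<^sub>C x)))"
  have L_add: "L (x + y) = L x + L y" if "x \<in> V" "y \<in> V" for x y
    using that by (simp add: L_def g_add scaleC_add_right complex_eq_iff)
  have L_scale: "L (c *\<^sub>C x) = c * L x" if x: "x \<in> V" for c x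
  proof -
    have 1: "c *\<^sub>C x = complex_of_real (Re c) *\<^sub>C x + complex_of_real (Im c) *\<^sub>C \<i> *\<^sub>C x"
      by (metis complex_eq mult.commute scaleC_add_left scaleC_scaleC)
    have "\<i> * c = complex_of_real (- Im c) + complex_of_real (Re c) * \<i>"
      by (simp add: complex_eq_iff)
    then have 2: "\<i> *\<^sub>C c *\<^sub>C x = complex_of_real (- Im c) *\<^sub>C x + complex_of_real (Re c) *\<^sub>C \<i> *\<^sub>C x"
      by (metis scaleC_add_left scaleC_scaleC)
    have "g (c *\<^sub>C x) = Re c * g x + Im c * g (\<i> *\<^sub>C x)"
      by (subst 1) (use x in \<open>simp add: g_add g_scale del: complex_vector.scale_scale\<close>)
    moreover have "g (\<i> *\<^sub>C c *\<^sub>C x) = - Im c * g x + Re c * g (\<i> *\<^sub>C x)"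
      by (subst 2) (use x in \<open>simp add: g_add g_scale del: of_real_minus complex_vector.scale_scale\<close>)
    ultimately show ?thesis by (simp add: L_def complex_eq_iff)
  qed
  show thesis
  proof (rule that[OF L_add L_scale])
    show "L x = l x" if "x \<in> W" for x
    proof -
      have "\<i> *\<^sub>C x \<in> W" using W that by (simp add: complex_vector.subspace_scale)
      then show ?thesis using gl[OF that] gl[of "\<i> *\<^sub>C x"] l_scale[OF that, of \<i>]
        by (simp add: L_def complex_eq_iff)
    qed
    show "cmod (L x) \<le> q x" if x: "x \<in> V" for x
    proof (cases "L x = 0")
      case True
      have "0 = q (0 *\<^sub>C x)" using q_scale[OF x, of 0] by simp
      have "q (x + (-1) *\<^sub>C x) \<le> q x + q ((-1) *\<^sub>C x)" using x by (intro q_add) auto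
      then have "0 \<le> 2 * q x" using q_scale[OF x, of "-1"] \<open>0 = q (0 *\<^sub>C x)\<close>
        by (simp add: scaleC_one complex_vector.scale_minus_left)
      then show ?thesis using True by simp
    next
      case False
      \<comment> \<open>rotate \<open>x\<close> so that \<open>L\<close> takes a positive real value, where it agrees with \<open>g\<close>\<close>
      define c where "c = cnj (L x) / cmod (L x)"
      have c1: "cmod c = 1" using False by (simp add: c_def norm_divide)
      have "L (c *\<^sub>C x) = complex_of_real (cmod (L x))"
        using False unfolding L_scale[OF x]
        by (simp add: c_def field_simps complex_norm_square power2_eq_square)
           (metis complex_norm_square mult.commute power2_eq_square of_real_mult)
      then have "cmod (L x) = g (c *\<^sub>C x)" by (simp add: L_def complex_eq_iff)
      also have "\<dots> \<le> q (c *\<^sub>C x)" using x by (intro gq) auto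
      finally show ?thesis using q_scale[OF x] c1 by simp
    qed
  qed
qed

section \<open>Uniform limits of holomorphic functions\<close>

lemma bounded_linear_scaleC_left: "bounded_linear (\<lambda>c. c *\<^sub>C (x::'a::complex_normed_vector))"
  by (rule bounded_linear_intro[where K = "norm x"])
     (auto simp: scaleC_add_left scaleR_scaleC[where 'a = 'a] norm_scaleC scaleR_conv_of_real)

text \<open>The one-variable Cauchy inequality on the complex line through \<open>x\<close> in direction \<open>h\<close>, on the disc
  of radius half the admissible one.\<close>
lemma cauchy_estimate:
  fixes g :: "'e::complex_normed_vector \<Rightarrow> complex"
  assumes r: "0 < r"
    and diff: "\<And>y. y \<in> ball x r \<Longrightarrow> \<exists>D'. (g has_derivative D') (at y) \<and> (\<forall>c h. D' (c *\<^sub>C h) = c * D' h)"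
    and bound: "\<And>y. y \<in> ball x r \<Longrightarrow> cmod (g y) \<le> B"
    and D: "(g has_derivative D) (at x)" "\<And>c h. D (c *\<^sub>C h) = c * D h"
  shows "cmod (D h) \<le> 2 * B / r * norm h"
proof (cases "h = 0")
  case True
  then show ?thesis using D(2)[of 0 0] by simp
next
  case False
  define \<rho> where "\<rho> = r / (2 * norm h)"
  have \<rho>: "\<rho> > 0" using r False by (simp add: \<rho>_def)
  define \<phi> where "\<phi> = (\<lambda>t. g (x + t *\<^sub>C h))"
  have mem: "x + t *\<^sub>C h \<in> ball x r" if "cmod t \<le> \<rho>" for t
  proof -
    have "norm (t *\<^sub>C h) \<le> \<rho> * norm h" using that by (simp add: norm_scaleC mult_right_mono)
    also have "\<dots> < r" using False r by (simp add: \<rho>_def)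
    finally show ?thesis by (simp add: dist_norm)
  qed
  have chain: "(\<phi> has_field_derivative D' h) (at t)"
    if "(g has_derivative D') (at (x + t *\<^sub>C h))" "\<And>c h. D' (c *\<^sub>C h) = c * D' h" for t D'
  proof -
    have "((\<lambda>t. x + t *\<^sub>C h) has_derivative (\<lambda>s. s *\<^sub>C h)) (at t)"
      using has_derivative_add[OF has_derivative_const
          bounded_linear_imp_has_derivative[OF bounded_linear_scaleC_left]] by fastforce
    from has_derivative_compose[OF this that(1)] show ?thesis
      unfolding has_field_derivative_def \<phi>_def that(2) mult.commute[of "D' h"] .
  qed
  have fd: "\<phi> field_differentiable (at t)" if "cmod t \<le> \<rho>" for t
    using diff[OF mem[OF that]] chain unfolding field_differentiable_def by blast
  have "cmod ((deriv ^^ 1) \<phi> 0) \<le> fact 1 * B / \<rho> ^ 1"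
  proof (rule Cauchy_inequality)
    show "\<phi> holomorphic_on ball 0 \<rho>"
      unfolding holomorphic_on_def by (auto intro!: field_differentiable_at_within fd)
    show "continuous_on (cball 0 \<rho>) \<phi>"
      by (intro holomorphic_on_imp_continuous_on)
         (auto simp: holomorphic_on_def intro!: field_differentiable_at_within fd)
    show "cmod (\<phi> t) \<le> B" if "cmod (0 - t) = \<rho>" for t
      unfolding \<phi>_def using that by (intro bound mem) simp
  qed (use \<rho> in auto)
  moreover have "deriv \<phi> 0 = D h"
    by (rule DERIV_imp_deriv, rule chain) (use D in auto)
  ultimately show ?thesis using r by (simp add: \<rho>_def field_simps)
qed

text \<open>Weierstrass's theorem. By the Cauchy estimate, uniform closeness of the functions forces uniform
  closeness of their derivatives in operator norm on a smaller ball, so the derivatives converge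
  uniformly there and the limit may be differentiated termwise. The limit of complex-linear
  derivatives is complex-linear.\<close>
lemma cholomorphic_on_uniform_limit:
  fixes g :: "nat \<Rightarrow> 'e::complex_normed_vector \<Rightarrow> complex"
  assumes U: "open U" and g: "\<And>n. cholomorphic_on (g n) U"
    and lim: "uniform_limit U g G sequentially"
  shows "cholomorphic_on G U"
  unfolding cholomorphic_on_def
proof
  fix x assume x: "x \<in> U"
  obtain r' where r': "r' > 0" "ball x r' \<subseteq> U" using U x openE by blast
  define r where "r = r' / 2"
  have r: "r > 0" "ball x (2 * r) \<subseteq> U" using r' by (auto simp: r_def)
  have "\<exists>D. \<forall>y\<in>U. (g n has_derivative D y) (at y) \<and> (\<forall>c h. D y (c *\<^sub>C h) = c * D y h)" for n
    using g[of n] unfolding cholomorphic_on_def scaleC_complex_def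
    by (intro bchoice) (metis U at_within_open)
  then obtain D where D: "\<And>n y. y \<in> U \<Longrightarrow> (g n has_derivative D n y) (at y)"
    "\<And>n y c h. y \<in> U \<Longrightarrow> D n y (c *\<^sub>C h) = c * D n y h"
    by metis
  have sub: "y + z \<in> U" if "y \<in> ball x r" "norm z < r" for y z
  proof -
    have "dist x (y + z) \<le> dist x y + norm z"
      by (metis dist_norm dist_triangle add_diff_cancel_left' dist_commute)
    then show ?thesis using that r by auto
  qed
  have est: "cmod (D n y h - D m y h) \<le> 2 * B / r * norm h"
    if y: "y \<in> ball x r" and B: "\<And>z. z \<in> U \<Longrightarrow> cmod (g n z - g m z) \<le> B" for n m y h B
  proof (rule cauchy_estimate[OF r(1), of y "\<lambda>z. g n z - g m z" B "\<lambda>h. D n y h - D m y h"])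
    have yU: "y \<in> U" using sub[OF y, of 0] r by simp
    have bU: "z \<in> U" if "z \<in> ball y r" for z
      using sub[OF y, of "z - y"] that by (simp add: dist_norm norm_minus_commute)
    show "\<exists>D'. ((\<lambda>z. g n z - g m z) has_derivative D') (at z) \<and> (\<forall>c h. D' (c *\<^sub>C h) = c * D' h)"
      if "z \<in> ball y r" for z
      by (rule exI[of _ "\<lambda>h. D n z h - D m z h"])
         (use D bU[OF that] in \<open>auto intro!: has_derivative_diff simp: algebra_simps\<close>)
    show "((\<lambda>z. g n z - g m z) has_derivative (\<lambda>h. D n y h - D m y h)) (at y)"
      using D yU by (auto intro!: has_derivative_diff)
    show "D n y (c *\<^sub>C h) - D m y (c *\<^sub>C h) = c * (D n y h - D m y h)" for c h
      using D yU by (simp add: algebra_simps)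
    show "cmod (g n z - g m z) \<le> B" if "z \<in> ball y r" for z
      using B bU that by blast
  qed
  have cau: "\<exists>N. \<forall>m\<ge>N. \<forall>n\<ge>N. \<forall>y\<in>ball x r. \<forall>h. cmod (D n y h - D m y h) \<le> e * norm h" if e: "e > 0" for e
  proof -
    have "uniformly_Cauchy_on U g" using lim by (auto simp: uniformly_convergent_eq_Cauchy[symmetric] uniformly_convergent_on_def)
    moreover have "e * r / 2 > 0" using e r by simp
    ultimately obtain N where N: "\<And>z m n. z \<in> U \<Longrightarrow> m \<ge> N \<Longrightarrow> n \<ge> N \<Longrightarrow> dist (g m z) (g n z) < e * r / 2"
      unfolding uniformly_Cauchy_on_def by metis
    have "cmod (D n y h - D m y h) \<le> 2 * (e * r / 2) / r * norm h" if "m \<ge> N" "n \<ge> N" "y \<in> ball x r" for n m y h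
      using that N by (intro est) (auto simp: dist_norm intro: less_imp_le)
    then show ?thesis using r by (intro exI[of _ N]) auto
  qed
  define D' where "D' = (\<lambda>y h. lim (\<lambda>n. D n y h))"
  have D': "(\<lambda>n. D n y h) \<longlonglongrightarrow> D' y h" if y: "y \<in> ball x r" for y h
  proof -
    have "Cauchy (\<lambda>n. D n y h)"
    proof (rule metric_CauchyI)
      fix e :: real assume "e > 0"
      have pos: "norm h + 1 > 0" by (simp add: add_nonneg_pos)
      have e: "e / (norm h + 1) > 0" using \<open>e > 0\<close> pos by simp
      have "e / (norm h + 1) * norm h < e"
        using \<open>e > 0\<close> pos by (simp only: times_divide_eq_left pos_divide_less_eq) (simp add: algebra_simps)
      then show "\<exists>N. \<forall>m\<ge>N. \<forall>n\<ge>N. dist (D m y h) (D n y h) < e"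
        using cau[OF e] y unfolding dist_norm by (meson le_less_trans)
    qed
    then have "convergent (\<lambda>n. D n y h)" by (rule Cauchy_convergent)
    then show ?thesis unfolding D'_def by (rule convergent_LIMSEQ_iff[THEN iffD1])
  qed
  have "\<exists>G'. \<forall>y\<in>ball x r. (\<lambda>n. g n y) \<longlonglongrightarrow> G' y \<and> (G' has_derivative D' y) (at y within ball x r)"
  proof (rule has_derivative_sequence[where f = g and f' = D and g' = D' and l = "G x" and ?x0.0 = x])
    show "(g n has_derivative D n y) (at y within ball x r)" if "y \<in> ball x r" for n y
      by (rule has_derivative_at_withinI, rule D(1)) (use sub[OF that, of 0] r(1) in simp)
    show "\<forall>\<^sub>F n in sequentially. \<forall>y\<in>ball x r. \<forall>h. cmod (D n y h - D' y h) \<le> e * norm h" if e: "e > 0" for e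
    proof -
      obtain N where N: "\<And>m n y h. m \<ge> N \<Longrightarrow> n \<ge> N \<Longrightarrow> y \<in> ball x r \<Longrightarrow> cmod (D n y h - D m y h) \<le> e * norm h"
        using cau[OF e] by metis
      have "cmod (D n y h - D' y h) \<le> e * norm h" if "n \<ge> N" "y \<in> ball x r" for n y h
      proof (rule LIMSEQ_le_const2)
        show "(\<lambda>m. cmod (D n y h - D m y h)) \<longlonglongrightarrow> cmod (D n y h - D' y h)"
          by (intro tendsto_intros D' that)
      qed (use N that in blast)
      then show ?thesis unfolding eventually_sequentially by blast
    qed
    show "(\<lambda>n. g n x) \<longlonglongrightarrow> G x"
      using tendsto_uniform_limitI[OF lim x] .
  qed (use r(1) in auto)
  then obtain G' where G': "\<And>y. y \<in> ball x r \<Longrightarrow> (\<lambda>n. g n y) \<longlonglongrightarrow> G' y"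
    "\<And>y. y \<in> ball x r \<Longrightarrow> (G' has_derivative D' y) (at y within ball x r)" by blast
  have eq: "G' y = G y" if "y \<in> ball x r" for y
    using G'(1)[OF that] tendsto_uniform_limitI[OF lim, of y] sub[OF that, of 0] r LIMSEQ_unique by fastforce
  have xb: "x \<in> ball x r" using r by simp
  have "(G' has_derivative D' x) (at x)" using G'(2)[OF xb] by (simp only: at_within_open[OF xb open_ball])
  then have "(G has_derivative D' x) (at x)"
    by (rule has_derivative_transform_within_open[OF _ open_ball xb]) (use eq in auto)
  moreover have "D' x (c *\<^sub>C h) = c *\<^sub>C D' x h" for c h
  proof (rule LIMSEQ_unique[OF D'[OF xb]])
    show "(\<lambda>n. D n x (c *\<^sub>C h)) \<longlonglongrightarrow> c *\<^sub>C D' x h"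
      unfolding D(2)[OF x] scaleC_complex_def by (intro tendsto_intros D' xb)
  qed
  ultimately show "\<exists>D. (G has_derivative D) (at x within U) \<and> (\<forall>c h. D (c *\<^sub>C h) = c *\<^sub>C D h)"
    using has_derivative_at_withinI by blast
qed

section \<open>The dual ball of \<open>\<ell>\<^sub>p\<close>\<close>

text \<open>The unit ball of the dual of \<open>\<ell>\<^sub>p\<close>, described through the pairing: by Hoelder's inequality this is the ball of
  \<open>\<ell>\<^sub>q\<close> for the conjugate exponent \<open>q\<close>, and of \<open>\<ell>\<^sub>\<infinity>\<close> for \<open>p = 1\<close>. The description treats all
  \<open>p\<close> alike, and since it only tests finite index sets it applies to coefficients indexed by pairs
  as well as by natural numbers.\<close>
definition dual_ball :: "real \<Rightarrow> ('i \<Rightarrow> complex) set" where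
  "dual_ball p = {a. \<forall>I x. finite I \<longrightarrow> (\<forall>i. 0 \<le> x i) \<longrightarrow>
     (\<Sum>i\<in>I. cmod (a i) * x i) \<le> (\<Sum>i\<in>I. x i powr p) powr (1 / p)}"

lemma dual_ballD:
  assumes "a \<in> dual_ball p" "finite I" "\<And>i. i \<in> I \<Longrightarrow> 0 \<le> x i"
  shows "(\<Sum>i\<in>I. cmod (a i) * x i) \<le> (\<Sum>i\<in>I. x i powr p) powr (1 / p)"
proof -
  let ?y = "\<lambda>i. if i \<in> I then x i else 0"
  have "(\<Sum>i\<in>I. cmod (a i) * ?y i) \<le> (\<Sum>i\<in>I. ?y i powr p) powr (1 / p)"
    using assms unfolding dual_ball_def mem_Collect_eq by (elim allE[of _ I] allE[of _ ?y]) auto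
  then show ?thesis by (simp cong: sum.cong)
qed

text \<open>The dual ball is convex and solid; this combines both properties.\<close>
lemma dual_ball_dominated:
  fixes a b c :: "'a \<Rightarrow> complex"
  assumes a: "a \<in> dual_ball p" and b: "b \<in> dual_ball p"
    and le: "\<And>i. cmod (c i) \<le> s * cmod (a i) + t * cmod (b i)"
    and st: "0 \<le> s" "0 \<le> t" "s + t \<le> 1"
  shows "c \<in> dual_ball p"
  unfolding dual_ball_def
proof (intro CollectI allI impI)
  fix I :: "'a set" and x :: "'a \<Rightarrow> real" assume I: "finite I" and x: "\<forall>i. 0 \<le> x i"
  let ?R = "(\<Sum>i\<in>I. x i powr p) powr (1 / p)"
  have "(\<Sum>i\<in>I. cmod (c i) * x i) \<le> (\<Sum>i\<in>I. (s * cmod (a i) + t * cmod (b i)) * x i)"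
    using x le by (intro sum_mono mult_right_mono) auto
  also have "\<dots> = s * (\<Sum>i\<in>I. cmod (a i) * x i) + t * (\<Sum>i\<in>I. cmod (b i) * x i)"
    by (simp add: sum_distrib_left sum.distrib algebra_simps)
  also have "\<dots> \<le> s * ?R + t * ?R"
    using st x I a b by (intro add_mono mult_left_mono dual_ballD) auto
  also have "\<dots> = (s + t) * ?R" by (simp add: algebra_simps)
  also have "\<dots> \<le> ?R" using st by (intro mult_left_le_one_le) auto
  finally show "(\<Sum>i\<in>I. cmod (c i) * x i) \<le> ?R" .
qed

text \<open>The sup norm, which the \<open>\<ell>\<^sub>1\<close> norm is paired with, is at most the \<open>\<ell>\<^sub>p\<close> norm.\<close>
lemma dual_ball_l1:
  fixes a :: "'i \<Rightarrow> complex"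
  assumes p: "p \<ge> 1" and J: "finite J" "(\<Sum>i\<in>J. cmod (a i)) \<le> 1" "\<And>i. i \<notin> J \<Longrightarrow> a i = 0"
  shows "a \<in> dual_ball p"
  unfolding dual_ball_def
proof (intro CollectI allI impI)
  fix I :: "'i set" and x :: "'i \<Rightarrow> real" assume I: "finite I" and x: "\<forall>i. 0 \<le> x i"
  let ?R = "(\<Sum>i\<in>I. x i powr p) powr (1 / p)"
  have "x i \<le> ?R" if "i \<in> I" for i
  proof -
    have "x i = (x i powr p) powr (1 / p)" using p x by (simp add: powr_powr)
    also have "\<dots> \<le> ?R"
      using p that I by (intro powr_mono2 member_le_sum) auto
    finally show ?thesis .
  qed
  then have "(\<Sum>i\<in>I. cmod (a i) * x i) \<le> (\<Sum>i\<in>I. cmod (a i) * ?R)"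
    by (intro sum_mono mult_left_mono) auto
  also have "\<dots> = (\<Sum>i\<in>I \<inter> J. cmod (a i)) * ?R"
    unfolding sum_distrib_right[symmetric] using I J(3)
    by (subst sum.mono_neutral_right[of I "I \<inter> J"]) auto
  also have "\<dots> \<le> (\<Sum>i\<in>J. cmod (a i)) * ?R"
    using J by (intro mult_right_mono sum_mono2) auto
  also have "\<dots> \<le> 1 * ?R" using J by (intro mult_right_mono) auto
  finally show "(\<Sum>i\<in>I. cmod (a i) * x i) \<le> ?R" by simp
qed

text \<open>Countably many coefficient sequences are glued into one: block \<open>k\<close>, scaled by \<open>w k\<close>, pairs with \<open>x\<close>
  to at most \<open>w k\<close> times the norm of the whole of \<open>x\<close>, and the weights add up to at most \<open>1\<close>.\<close>
lemma dual_ball_blocks: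
  fixes a :: "'k \<Rightarrow> 'n \<Rightarrow> complex"
  assumes p: "p \<ge> 1" and a: "\<And>k. a k \<in> dual_ball p"
    and w: "\<And>k. 0 \<le> w k" "\<And>K. finite K \<Longrightarrow> sum w K \<le> 1"
  shows "(\<lambda>(k, n). of_real (w k) * a k n) \<in> dual_ball p"
  unfolding dual_ball_def
proof (intro CollectI allI impI)
  fix I :: "('k \<times> 'n) set" and x :: "'k \<times> 'n \<Rightarrow> real" assume I: "finite I" and x: "\<forall>i. 0 \<le> x i"
  let ?R = "(\<Sum>i\<in>I. x i powr p) powr (1 / p)"
  define K where "K = fst ` I"
  define J where "J k = {n. (k, n) \<in> I}" for k
  have IK: "I = Sigma K J" and K: "finite K" using I by (force simp: K_def J_def)+
  have J: "finite (J k)" for k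
    by (rule finite_subset[of _ "snd ` I"]) (use I in \<open>force simp: J_def\<close>)+
  have "(\<Sum>i\<in>I. cmod (case i of (k, n) \<Rightarrow> of_real (w k) * a k n) * x i) =
      (\<Sum>k\<in>K. w k * (\<Sum>n\<in>J k. cmod (a k n) * x (k, n)))"
  proof -
    have "(\<Sum>k\<in>K. w k * (\<Sum>n\<in>J k. cmod (a k n) * x (k, n))) =
        (\<Sum>k\<in>K. \<Sum>n\<in>J k. cmod (case (k, n) of (k, n) \<Rightarrow> of_real (w k) * a k n) * x (k, n))"
      using w by (simp add: sum_distrib_left norm_mult mult.assoc)
    also have "\<dots> = (\<Sum>i\<in>I. cmod (case i of (k, n) \<Rightarrow> of_real (w k) * a k n) * x i)"
      unfolding IK by (subst sum.Sigma) (use K J in \<open>auto intro!: sum.cong\<close>)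
    finally show ?thesis by simp
  qed
  also have "\<dots> \<le> (\<Sum>k\<in>K. w k * ?R)"
  proof (intro sum_mono mult_left_mono w)
    fix k assume k: "k \<in> K"
    have "(\<Sum>n\<in>J k. cmod (a k n) * x (k, n)) \<le> (\<Sum>n\<in>J k. x (k, n) powr p) powr (1 / p)"
      using x by (intro dual_ballD a J) auto
    also have "(\<Sum>n\<in>J k. x (k, n) powr p) = (\<Sum>i\<in>Pair k ` J k. x i powr p)"
      by (subst sum.reindex) (auto simp: inj_on_def)
    also have "\<dots> powr (1 / p) \<le> ?R"
      using p I by (intro powr_mono2 sum_mono2) (auto simp: J_def intro: sum_nonneg)
    finally show "(\<Sum>n\<in>J k. cmod (a k n) * x (k, n)) \<le> ?R" .
  qed
  also have "\<dots> = sum w K * ?R" by (simp add: sum_distrib_right)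
  also have "\<dots> \<le> 1 * ?R" using w K by (intro mult_right_mono) auto
  finally show "(\<Sum>i\<in>I. cmod (case i of (k, n) \<Rightarrow> of_real (w k) * a k n) * x i) \<le> ?R" by simp
qed

lemma dual_ball_reindex:
  fixes g :: "'b \<Rightarrow> 'a"
  assumes a: "a \<in> dual_ball p" and g: "inj g"
  shows "(\<lambda>i. a (g i)) \<in> dual_ball p"
  unfolding dual_ball_def
proof (intro CollectI allI impI)
  fix I :: "'b set" and x :: "'b \<Rightarrow> real" assume I: "finite I" and x: "\<forall>i. 0 \<le> x i"
  have "(\<Sum>i\<in>g ` I. cmod (a i) * x (inv g i)) \<le> (\<Sum>i\<in>g ` I. x (inv g i) powr p) powr (1 / p)"
    using x I by (intro dual_ballD a) auto
  then show "(\<Sum>i\<in>I. cmod (a (g i)) * x i) \<le> (\<Sum>i\<in>I. x i powr p) powr (1 / p)"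
    by (simp add: sum.reindex inj_on_subset[OF g] g)
qed

text \<open>Hoelder's inequality, from Young's inequality for \<open>x\<close> normalised in \<open>\<ell>\<^sub>p\<close>.\<close>
lemma coeff_ball_subset_dual_ball:
  assumes p: "p \<ge> 1"
  shows "coeff_ball p \<subseteq> dual_ball p"
proof
  fix a assume a: "a \<in> coeff_ball p"
  show "a \<in> dual_ball p"
    unfolding dual_ball_def
  proof (intro CollectI allI impI)
    fix I :: "nat set" and x :: "nat \<Rightarrow> real" assume I: "finite I" and x: "\<forall>i. 0 \<le> x i"
    define R where "R = (\<Sum>i\<in>I. x i powr p) powr (1 / p)"
    show "(\<Sum>i\<in>I. cmod (a i) * x i) \<le> (\<Sum>i\<in>I. x i powr p) powr (1 / p)"
    proof (cases "p = 1")
      case True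
      then have "(\<Sum>i\<in>I. cmod (a i) * x i) \<le> (\<Sum>i\<in>I. 1 * x i)"
        using a x by (intro sum_mono mult_right_mono) (auto simp: coeff_ball_def)
      then show ?thesis using True x by (simp add: sum_nonneg)
    next
      case False
      define q where "q = p / (p - 1)"
      have p1: "p > 1" using p False by simp
      have q: "q > 1" "1 / q + 1 / p = 1" using p1 by (auto simp: q_def field_simps)
      have aq: "a \<in> lp q" "lp_norm q a \<le> 1" using a False by (auto simp: coeff_ball_def q_def)
      have "(\<Sum>n. cmod (a n) powr q) = lp_norm q a powr q"
        using lp_norm_powr[of q a] q aq by simp
      also have "\<dots> \<le> 1 powr q" using q aq lp_norm_nonneg[of q a] by (intro powr_mono2) auto
      finally have aq1: "(\<Sum>n. cmod (a n) powr q) \<le> 1" by simp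
      have aI: "(\<Sum>i\<in>I. cmod (a i) powr q) \<le> 1"
        by (rule order_trans[OF sum_le_suminf aq1]) (use aq I in \<open>auto simp: lp_def\<close>)
      have Rp: "R powr p = (\<Sum>i\<in>I. x i powr p)"
        using p by (simp add: R_def powr_powr sum_nonneg)
      show ?thesis
      proof (cases "R = 0")
        case True
        then have "\<forall>i\<in>I. x i = 0" using Rp I p by (simp add: sum_nonneg_eq_0_iff)
        then show ?thesis by simp
      next
        case False
        then have R: "R > 0" by (simp add: R_def order_less_le)
        have "(\<Sum>i\<in>I. cmod (a i) * (x i / R)) \<le> (\<Sum>i\<in>I. cmod (a i) powr q / q + (x i / R) powr p / p)"
          using q p1 x R by (intro sum_mono Youngs_inequality) auto
        also have "\<dots> = (\<Sum>i\<in>I. cmod (a i) powr q) / q + (\<Sum>i\<in>I. x i powr p) / R powr p / p"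
          using R x by (simp add: sum.distrib sum_divide_distrib powr_divide)
        also have "\<dots> = (\<Sum>i\<in>I. cmod (a i) powr q) / q + 1 / p"
          using R by (simp add: Rp[symmetric])
        also have "\<dots> \<le> 1 / q + 1 / p"
          using aI q by (intro add_right_mono divide_right_mono) auto
        finally have "(\<Sum>i\<in>I. cmod (a i) * x i) / R \<le> 1"
          using q by (simp add: sum_divide_distrib)
        then show ?thesis using R by (simp add: R_def[symmetric])
      qed
    qed
  qed
qed

text \<open>The converse of Hoelder's inequality, by testing against \<open>|a\<^sub>n|\<^bsup>q-1\<^esup>\<close>. Convergence to zero makes the
  difference between \<open>\<ell>\<^sub>\<infinity>\<close> and \<open>c\<^sub>0\<close> when \<open>p = 1\<close>.\<close>
lemma null_dual_ball_subset_coeff_ball: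
  assumes p: "p \<ge> 1" and a: "a \<in> dual_ball p" and null: "a \<longlonglongrightarrow> 0"
  shows "a \<in> coeff_ball p"
proof (cases "p = 1")
  case True
  have "cmod (a n) \<le> 1" for n
    using dual_ballD[OF a, of "{n}" "\<lambda>_. 1"] by simp
  then show ?thesis using null True by (simp add: coeff_ball_def)
next
  case False
  define q where "q = p / (p - 1)"
  have p1: "p > 1" using p False by simp
  have q: "q > 1" "(q - 1) * p = q" using p1 by (auto simp: q_def field_simps)
  have fin: "(\<Sum>i\<in>I. cmod (a i) powr q) \<le> 1" if I: "finite I" for I
  proof (rule ccontr)
    define T where "T = (\<Sum>i\<in>I. cmod (a i) powr q)"
    assume "\<not> (\<Sum>i\<in>I. cmod (a i) powr q) \<le> 1"
    then have T: "T > 1" by (simp add: T_def)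
    have "T = (\<Sum>i\<in>I. cmod (a i) * cmod (a i) powr (q - 1))"
      unfolding T_def by (intro sum.cong refl) (use powr_mult_base[of "cmod _" "q - 1"] in simp)
    also have "\<dots> \<le> (\<Sum>i\<in>I. (cmod (a i) powr (q - 1)) powr p) powr (1 / p)"
      using I by (intro dual_ballD a) auto
    also have "\<dots> = T powr (1 / p)" by (simp add: T_def powr_powr q)
    also have "\<dots> < T powr 1" using T p1 by (intro powr_less_mono) auto
    finally show False using T by simp
  qed
  have "summable (\<lambda>n. cmod (a n) powr q)"
    by (rule summableI_nonneg_bounded[of _ 1]) (auto intro: fin)
  moreover from this have "(\<Sum>n. cmod (a n) powr q) \<le> 1"
    by (rule suminf_le_const) (auto intro: fin)
  then have "lp_norm q a \<le> 1 powr (1 / q)"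
    unfolding lp_norm_def using q \<open>summable _\<close> by (intro powr_mono2) (auto intro: suminf_nonneg)
  ultimately show ?thesis using False by (simp add: coeff_ball_def lp_def q_def)
qed

section \<open>Pairing the dual ball with \<open>\<ell>\<^sub>p\<close>\<close>

lemma dual_ball_pairing:
  fixes x :: "nat \<Rightarrow> 'a::real_normed_vector"
  assumes p: "p \<ge> 1" and a: "a \<in> dual_ball p" and x: "x \<in> lp p"
  shows "summable (\<lambda>n. cmod (a n) * norm (x n))"
    and "(\<Sum>n. cmod (a n) * norm (x n)) \<le> lp_norm p x"
proof -
  have "(\<Sum>n<N. cmod (a n) * norm (x n)) \<le> lp_norm p x" for N
  proof -
    have "(\<Sum>n<N. cmod (a n) * norm (x n)) \<le> (\<Sum>n<N. norm (x n) powr p) powr (1 / p)"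
      by (intro dual_ballD a) auto
    also have "\<dots> \<le> lp_norm p x"
      unfolding lp_norm_def using p x
      by (intro powr_mono2 sum_le_suminf) (auto simp: lp_def intro: sum_nonneg)
    finally show ?thesis .
  qed
  then show *: "summable (\<lambda>n. cmod (a n) * norm (x n))"
    by (intro summableI_nonneg_bounded) auto
  show "(\<Sum>n. cmod (a n) * norm (x n)) \<le> lp_norm p x"
    by (rule suminf_le_const[OF *]) fact
qed

lemma dual_ball_complex_pairing:
  fixes u :: "nat \<Rightarrow> complex"
  assumes p: "p \<ge> 1" and a: "a \<in> dual_ball p" and u: "u \<in> lp p"
  shows "summable (\<lambda>n. a n * u n)" and "cmod (\<Sum>n. a n * u n) \<le> lp_norm p u"
proof -
  note * = dual_ball_pairing[OF p a u]
  show "summable (\<lambda>n. a n * u n)"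
    by (rule summable_norm_cancel) (use *(1) in \<open>simp add: norm_mult\<close>)
  have "cmod (\<Sum>n. a n * u n) \<le> (\<Sum>n. cmod (a n * u n))"
    by (rule summable_norm) (use *(1) in \<open>simp add: norm_mult\<close>)
  then show "cmod (\<Sum>n. a n * u n) \<le> lp_norm p u"
    using *(2) by (simp add: norm_mult)
qed

lemma lp_mono:
  assumes p: "p \<ge> 1" and "y \<in> lp p" "\<And>n. norm (x n) \<le> C * norm (y n)" and C: "C \<ge> 0"
  shows "x \<in> lp p" "lp_norm p x \<le> C * lp_norm p y"
proof -
  have le: "norm (x n) powr p \<le> C powr p * norm (y n) powr p" for n
    using assms by (subst powr_mult[symmetric]) (intro powr_mono2, auto)
  have y: "summable (\<lambda>n. norm (y n) powr p)" using assms by (simp add: lp_def)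
  have sx: "summable (\<lambda>n. norm (x n) powr p)"
    by (rule summable_comparison_test'[OF summable_mult[OF y, of "C powr p"], of 0]) (use le in auto)
  then show "x \<in> lp p" by (simp add: lp_def)
  have "lp_norm p x \<le> (\<Sum>n. C powr p * norm (y n) powr p) powr (1 / p)"
    unfolding lp_norm_def
  proof (rule powr_mono2)
    show "(\<Sum>n. norm (x n) powr p) \<le> (\<Sum>n. C powr p * norm (y n) powr p)"
      by (rule suminf_le[OF le sx summable_mult[OF y]])
  qed (use p sx in \<open>auto intro: suminf_nonneg\<close>)
  also have "\<dots> = (C powr p * (\<Sum>n. norm (y n) powr p)) powr (1 / p)"
    by (simp only: suminf_mult[OF y])
  also have "\<dots> = C * lp_norm p y"
    using p C by (simp add: lp_norm_def powr_mult powr_powr)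
  finally show "lp_norm p x \<le> C * lp_norm p y" .
qed

lemma lp_scaleC:
  fixes x :: "nat \<Rightarrow> 'a::complex_normed_vector"
  assumes p: "p \<ge> 1" and x: "x \<in> lp p"
  shows "c *\<^sub>C x \<in> lp p" "lp_norm p (c *\<^sub>C x) = cmod c * lp_norm p x"
proof -
  show 1: "c *\<^sub>C x \<in> lp p"
    by (rule lp_mono[OF p x, of _ "cmod c"]) (auto simp: scaleC_fun_def norm_scaleC)
  show "lp_norm p (c *\<^sub>C x) = cmod c * lp_norm p x"
    using p x suminf_mult[of "\<lambda>n. norm (x n) powr p" "cmod c powr p"]
    by (simp add: lp_norm_def lp_def scaleC_fun_def norm_scaleC powr_mult powr_powr suminf_nonneg)
qed

lemma lp_subspace:
  assumes p: "p \<ge> 1"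
  shows "complex_vector.subspace (lp p :: (nat \<Rightarrow> 'a::complex_normed_vector) set)"
  by (rule complex_vector.subspaceI) (use minkowski_lp(1)[OF p] lp_scaleC(1)[OF p] in \<open>auto simp: lp_def\<close>)

lemma lp_tail_tendsto_0:
  assumes p: "p \<ge> 1" and x: "x \<in> lp p"
  shows "(\<lambda>N. lp_norm p (\<lambda>n. if n < N then 0 else x n)) \<longlonglongrightarrow> 0"
proof -
  have s: "summable (\<lambda>n. norm (x n) powr p)" using x by (simp add: lp_def)
  have "lp_norm p (\<lambda>n. if n < N then 0 else x n) =
      ((\<Sum>n. norm (x n) powr p) - (\<Sum>n<N. norm (x n) powr p)) powr (1 / p)" for N
  proof -
    let ?f = "\<lambda>n. norm (if n < N then 0 else x n) powr p"
    have "summable ?f" by (rule summable_comparison_test'[OF s, of 0]) auto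
    then have "suminf ?f = (\<Sum>n. ?f (n + N)) + (\<Sum>n<N. ?f n)"
      by (rule suminf_split_initial_segment)
    also have "\<dots> = (\<Sum>n. norm (x (n + N)) powr p)" by simp
    also have "\<dots> = (\<Sum>n. norm (x n) powr p) - (\<Sum>n<N. norm (x n) powr p)"
      using suminf_split_initial_segment[OF s, of N] by simp
    finally show ?thesis by (simp add: lp_norm_def)
  qed
  moreover have "(\<lambda>N. ((\<Sum>n. norm (x n) powr p) - (\<Sum>n<N. norm (x n) powr p)) powr (1 / p)) \<longlonglongrightarrow> 0 powr (1 / p)"
  proof (rule tendsto_powr')
    show "(\<lambda>N. (\<Sum>n. norm (x n) powr p) - (\<Sum>n<N. norm (x n) powr p)) \<longlonglongrightarrow> 0"
      using tendsto_diff[OF tendsto_const summable_LIMSEQ[OF s], of "\<Sum>n. norm (x n) powr p"] by simp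
    show "(\<lambda>N. 1 / p) \<longlonglongrightarrow> 1 / p" by simp
    show "0 \<noteq> (0::real) \<or> 0 < 1 / p \<and> (\<forall>\<^sub>F N in sequentially. 0 \<le> (\<Sum>n. norm (x n) powr p) - (\<Sum>n<N. norm (x n) powr p))"
      using p s by (auto intro!: always_eventually sum_le_suminf)
  qed
  ultimately show ?thesis by simp
qed

section \<open>Functionals\<close>

lemma bounded_linear_cdual_apply: "bounded_linear (cdual_apply \<phi>)"
  using cdual_apply[of \<phi>] by simp

lemma cdual_apply_add: "cdual_apply \<phi> (x + y) = cdual_apply \<phi> x + cdual_apply \<phi> y"
  using linear_add[OF bounded_linear.linear[OF bounded_linear_cdual_apply]] .

lemma cdual_apply_diff: "cdual_apply \<phi> (x - y) = cdual_apply \<phi> x - cdual_apply \<phi> y"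
  using linear_diff[OF bounded_linear.linear[OF bounded_linear_cdual_apply]] .

lemma cdual_apply_0: "cdual_apply \<phi> 0 = 0"
  using linear_0[OF bounded_linear.linear[OF bounded_linear_cdual_apply]] .

lemma cdual_apply_sum: "cdual_apply \<phi> (sum g I) = (\<Sum>i\<in>I. cdual_apply \<phi> (g i))"
  using linear_sum[OF bounded_linear.linear[OF bounded_linear_cdual_apply]] .

lemma cdual_apply_scaleC: "cdual_apply \<phi> (c *\<^sub>C x) = c * cdual_apply \<phi> x"
  using cdual_apply[of \<phi>] by simp

lemmas cdual_apply_simps = cdual_apply_add cdual_apply_diff cdual_apply_0 cdual_apply_sum
  cdual_apply_scaleC plus_cdual.rep_eq minus_cdual.rep_eq zero_cdual.rep_eq scaleC_cdual.rep_eq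

lemma sum_cdual_apply: "cdual_apply (sum g I) x = (\<Sum>i\<in>I. cdual_apply (g i) x)"
  by (induction I rule: infinite_finite_induct) (simp_all add: cdual_apply_simps)

lemma cmod_cdual_apply_le: "cmod (cdual_apply \<phi> x) \<le> norm \<phi> * norm x"
  unfolding norm_cdual.rep_eq by (rule onorm[OF bounded_linear_cdual_apply])

lemma norm_cdual_le:
  assumes "0 \<le> B" "\<And>x. cmod (cdual_apply \<phi> x) \<le> B * norm x"
  shows "norm \<phi> \<le> B"
  unfolding norm_cdual.rep_eq using assms by (intro onorm_bound) auto

lemma cdual_apply_Cdual:
  assumes "\<And>x y. L (x + y) = L x + L y" "\<And>c x. L (c *\<^sub>C x) = c * L x" "\<And>x. cmod (L x) \<le> K * norm x"
  shows "cdual_apply (Cdual L) = L"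
proof (rule Cdual_inverse, intro CollectI conjI)
  show "bounded_linear L"
    by (rule bounded_linear_intro[where K = K])
       (use assms in \<open>auto simp: scaleR_scaleC scaleC_complex_def mult.commute\<close>)
qed (use assms in auto)

definition evaluation :: "'a::complex_normed_vector \<Rightarrow> 'a cdual cdual" where
  "evaluation x = Cdual (\<lambda>\<phi>. cdual_apply \<phi> x)"

lemma evaluation_apply: "cdual_apply (evaluation x) \<phi> = cdual_apply \<phi> x"
  unfolding evaluation_def
  by (subst cdual_apply_Cdual[where K = "norm x"])
     (auto simp: cdual_apply_simps mult.commute[of "norm x"] cmod_cdual_apply_le)

lemma norm_evaluation_le: "norm (evaluation x) \<le> norm x"
  by (rule norm_cdual_le) (auto simp: evaluation_apply mult.commute[of "norm x"] cmod_cdual_apply_le)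

section \<open>Factoring the transpose\<close>

lemma norm_le_Hinf_norm:
  assumes "g \<in> Hinf U" "x \<in> U"
  shows "norm (g x) \<le> Hinf_norm U g"
proof -
  have "bounded (g ` U)" using assms by (simp add: Hinf_def)
  then obtain B where "\<And>y. y \<in> U \<Longrightarrow> norm (g y) \<le> B"
    unfolding bounded_iff by auto
  then have "bdd_above (insert 0 ((\<lambda>x. norm (g x)) ` U))"
    by (auto simp: bdd_above_def intro!: exI[of _ "max 0 B"] le_max_iff_disj[THEN iffD2])
  then show ?thesis unfolding Hinf_norm_def using assms by (intro cSup_upper) auto
qed

lemma holo_transpose_in_Hinf:
  assumes f: "f \<in> Hinf U"
  shows "holo_transpose f \<phi> \<in> Hinf U"
proof -
  have "cholomorphic_on (cdual_apply \<phi> \<circ> f) U"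
    unfolding cholomorphic_on_def
  proof
    fix x assume "x \<in> U"
    then obtain D where D: "(f has_derivative D) (at x within U)" "\<And>c h. D (c *\<^sub>C h) = c *\<^sub>C D h"
      using f unfolding Hinf_def cholomorphic_on_def by blast
    have "((\<lambda>x. cdual_apply \<phi> (f x)) has_derivative (\<lambda>h. cdual_apply \<phi> (D h))) (at x within U)"
      by (rule bounded_linear.has_derivative[OF bounded_linear_cdual_apply D(1)])
    then show "\<exists>D. (cdual_apply \<phi> \<circ> f has_derivative D) (at x within U) \<and> (\<forall>c h. D (c *\<^sub>C h) = c *\<^sub>C D h)"
      using D(2) by (intro exI[of _ "\<lambda>h. cdual_apply \<phi> (D h)"])
        (auto simp: o_def cdual_apply_scaleC scaleC_complex_def)
  qed
  moreover have "bounded ((cdual_apply \<phi> \<circ> f) ` U)"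
    using f bounded_linear_image[OF _ bounded_linear_cdual_apply, of "f ` U" \<phi>]
    by (simp add: Hinf_def image_comp)
  ultimately show ?thesis
    using f by (auto simp: Hinf_def holo_transpose_def cdual_apply_0)
qed

lemma Hinf_subspace: "complex_vector.subspace (Hinf U :: ('a::complex_normed_vector \<Rightarrow> complex) set)"
proof (rule complex_vector.subspaceI)
  show "0 \<in> (Hinf U :: ('a \<Rightarrow> complex) set)"
    by (auto simp: Hinf_def cholomorphic_on_def scaleC_complex_def image_constant_conv zero_fun_def
        intro!: exI[of _ "\<lambda>_. 0"])
next
  fix g h :: "'a \<Rightarrow> complex" assume gh: "g \<in> Hinf U" "h \<in> Hinf U"
  have "cholomorphic_on (g + h) U"
    unfolding cholomorphic_on_def
  proof
    fix x assume "x \<in> U"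
    then obtain D D' where D: "(g has_derivative D) (at x within U)" "\<And>c h. D (c *\<^sub>C h) = c *\<^sub>C D h"
      "(h has_derivative D') (at x within U)" "\<And>c h. D' (c *\<^sub>C h) = c *\<^sub>C D' h"
      using gh unfolding Hinf_def cholomorphic_on_def by blast
    show "\<exists>D. (g + h has_derivative D) (at x within U) \<and> (\<forall>c h. D (c *\<^sub>C h) = c *\<^sub>C D h)"
      by (rule exI[of _ "\<lambda>h. D h + D' h"])
         (use D has_derivative_add[OF D(1,3)] in \<open>auto simp: plus_fun_def scaleC_add_right\<close>)
  qed
  moreover have "bounded ((g + h) ` U)"
    using bounded_plus_comp[of g U h] gh by (simp add: Hinf_def plus_fun_def)
  ultimately show "g + h \<in> Hinf U" using gh by (simp add: Hinf_def)
next
  fix c and g :: "'a \<Rightarrow> complex" assume g: "g \<in> Hinf U"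
  have "cholomorphic_on (c *\<^sub>C g) U"
    unfolding cholomorphic_on_def
  proof
    fix x assume "x \<in> U"
    then obtain D where D: "(g has_derivative D) (at x within U)" "\<And>c h. D (c *\<^sub>C h) = c *\<^sub>C D h"
      using g unfolding Hinf_def cholomorphic_on_def by blast
    show "\<exists>D. (c *\<^sub>C g has_derivative D) (at x within U) \<and> (\<forall>c h. D (c *\<^sub>C h) = c *\<^sub>C D h)"
      by (rule exI[of _ "\<lambda>h. c * D h"])
         (use D has_derivative_mult_right[OF D(1)] in \<open>auto simp: scaleC_fun_def scaleC_complex_def\<close>)
  qed
  moreover have "bounded ((c *\<^sub>C g) ` U)"
    using bounded_scaling[of "g ` U"] g bounded_linear_image[OF _ bounded_linear_mult_right, of "g ` U" c]
    by (simp add: Hinf_def scaleC_fun_def scaleC_complex_def image_image)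
  ultimately show "c *\<^sub>C g \<in> Hinf U" using g by (simp add: Hinf_def scaleC_fun_def scaleC_complex_def)
qed

text \<open>Write \<open>f u = \<Sum> a u n x\<^sub>n\<close> and put \<open>R \<phi> = (\<phi> x\<^sub>n)\<close>, \<open>S m u = \<Sum> a u n m\<^sub>n\<close>. Then \<open>S \<circ> R\<close> is the
  transpose of \<open>f\<close> and \<open>S\<close> is a contraction into the bounded functions on \<open>U\<close>. For an arbitrary
  \<open>m \<in> \<ell>\<^sub>p\<close> the function \<open>S m\<close> has no reason to be holomorphic, because the coefficients are chosen
  separately for every \<open>u\<close>. So \<open>M\<close> is taken to be the set of all \<open>m\<close> for which it is: this is a
  subspace containing the range of \<open>R\<close>, and it is closed because convergence in \<open>\<ell>\<^sub>p\<close> becomes uniform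
  convergence on \<open>U\<close>.\<close>
lemma transpose_factors_if_p_compact_range:
  fixes U :: "'e::complex_banach set" and f :: "'e \<Rightarrow> 'f::complex_banach"
  assumes U: "open U" and p: "1 \<le> p" and f: "f \<in> Hinf U" and K: "relatively_p_compact p (f ` U)"
  shows "\<exists>(M :: (nat \<Rightarrow> complex) set) R S.
       complex_vector.subspace M \<and> closedin (lp_topology p) M \<and>
       R \<in> quasi_p_nuclear_ops p M (lp_norm p) \<and>
       S \<in> bounded_ops M (lp_norm p) (Hinf U) (Hinf_norm U) \<and>
       holo_transpose f = S \<circ> R"
proof -
  obtain x where x: "x \<in> lp p" and fx: "f ` U \<subseteq> p_conv p x"
    using K unfolding relatively_p_compact_def by blast
  have "\<forall>u\<in>U. \<exists>a. a \<in> coeff_ball p \<and> (\<lambda>n. a n *\<^sub>C x n) sums f u"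
    using fx unfolding p_conv_def by blast
  then obtain a where a: "\<And>u. u \<in> U \<Longrightarrow> a u \<in> dual_ball p"
    and a_sums: "\<And>u. u \<in> U \<Longrightarrow> (\<lambda>n. a u n *\<^sub>C x n) sums f u"
    using coeff_ball_subset_dual_ball[OF p] by (metis subsetD)
  define S where "S = (\<lambda>m u. if u \<in> U then \<Sum>n. a u n * m n else (0::complex))"
  define M where "M = {m \<in> lp p. S m \<in> Hinf U}"
  define R where "R = (\<lambda>\<phi> n. cdual_apply \<phi> (x n))"
  have S_add: "S (m + m') = S m + S m'" if "m \<in> lp p" "m' \<in> lp p" for m m'
    using dual_ball_complex_pairing(1)[OF p a that(1)] dual_ball_complex_pairing(1)[OF p a that(2)]
    by (auto simp: S_def fun_eq_iff algebra_simps suminf_add)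
  have S_scale: "S (c *\<^sub>C m) = c *\<^sub>C S m" if "m \<in> lp p" for c m
    using suminf_mult[OF dual_ball_complex_pairing(1)[OF p a that], of _ c]
    by (auto simp: S_def fun_eq_iff scaleC_fun_def scaleC_complex_def algebra_simps)
  have S_bound: "cmod (S m u) \<le> lp_norm p m" if "m \<in> lp p" for m u
    using dual_ball_complex_pairing(2)[OF p a that] lp_norm_nonneg[of p m] by (simp add: S_def)
  have S_Hinf: "S m \<in> Hinf U \<longleftrightarrow> cholomorphic_on (S m) U" if "m \<in> lp p" for m
  proof -
    have "bounded (S m ` U)" using S_bound[OF that] by (auto simp: bounded_iff)
    then show ?thesis by (simp add: Hinf_def) (simp add: S_def)
  qed
  have R_lp: "R \<phi> \<in> lp p" "lp_norm p (R \<phi>) \<le> lp_norm p x * norm \<phi>" for \<phi>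
    using lp_mono[OF p x, of "R \<phi>" "norm \<phi>"] cmod_cdual_apply_le[of \<phi>]
    by (simp_all add: R_def mult.commute[of "lp_norm p x"])
  have SR: "S (R \<phi>) = holo_transpose f \<phi>" for \<phi>
  proof
    fix u
    show "S (R \<phi>) u = holo_transpose f \<phi> u"
    proof (cases "u \<in> U")
      case True
      have "(\<lambda>n. cdual_apply \<phi> (a u n *\<^sub>C x n)) sums cdual_apply \<phi> (f u)"
        by (rule bounded_linear.sums[OF bounded_linear_cdual_apply a_sums[OF True]])
      then show ?thesis using True
        by (simp add: S_def R_def holo_transpose_def cdual_apply_scaleC sums_iff)
    next
      case False
      then show ?thesis using f by (simp add: S_def holo_transpose_def Hinf_def cdual_apply_0)
    qed
  qed
  have M: "complex_vector.subspace M"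
    by (rule complex_vector.subspaceI)
       (use S_add S_scale S_scale[of 0 0] lp_subspace[OF p, where 'a = complex] Hinf_subspace[of U] in
         \<open>auto simp: M_def complex_vector.subspace_0 complex_vector.subspace_add complex_vector.subspace_scale\<close>)
  have closed: "closedin (lp_topology p) M"
  proof -
    interpret Metric_space "lp p :: (nat \<Rightarrow> complex) set" "\<lambda>x y. lp_norm p (x - y)"
      by (rule Metric_space_lp[OF p])
    have lim: "l \<in> M" if \<sigma>: "range \<sigma> \<subseteq> M" and l: "limitin mtopology \<sigma> l sequentially" for \<sigma> l
    proof -
      have lp: "l \<in> lp p" "\<And>k. \<sigma> k \<in> lp p" and hol: "\<And>k. cholomorphic_on (S (\<sigma> k)) U"
        using \<sigma> l by (auto simp: limitin_metric M_def Hinf_def)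
      have "uniform_limit U (\<lambda>k. S (\<sigma> k)) (S l) sequentially"
      proof (rule uniform_limitI)
        fix e :: real assume e: "e > 0"
        have "dist (S (\<sigma> k) u) (S l u) \<le> lp_norm p (\<sigma> k - l)" for k u
        proof -
          have d: "\<sigma> k - l \<in> lp p" by (rule complex_vector.subspace_diff[OF lp_subspace[OF p] lp(2,1)])
          have "S (\<sigma> k) = S (\<sigma> k - l) + S l" using S_add[OF d lp(1)] by simp
          then show ?thesis using S_bound[OF d, of u] by (simp add: dist_norm)
        qed
        moreover have "\<forall>\<^sub>F k in sequentially. \<sigma> k \<in> lp p \<and> lp_norm p (\<sigma> k - l) < e"
          using l e unfolding limitin_metric by blast
        ultimately show "\<forall>\<^sub>F k in sequentially. \<forall>u\<in>U. dist (S (\<sigma> k) u) (S l u) < e"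
          by (elim eventually_mono) (blast intro: le_less_trans)
      qed
      then have "cholomorphic_on (S l) U"
        by (rule cholomorphic_on_uniform_limit[OF U hol])
      then show ?thesis using lp S_Hinf by (simp add: M_def)
    qed
    have "M \<subseteq> lp p" by (auto simp: M_def)
    then show ?thesis
      unfolding lp_topology_def metric_closedin_iff_sequentially_closed using lim by blast
  qed
  have "R \<phi> \<in> M" for \<phi>
    using R_lp(1) holo_transpose_in_Hinf[OF f] by (simp add: M_def SR)
  moreover have "R (\<phi> + \<psi>) = R \<phi> + R \<psi>" "R (c *\<^sub>C \<phi>) = c *\<^sub>C R \<phi>" for \<phi> \<psi> c
    by (simp_all add: R_def fun_eq_iff cdual_apply_simps scaleC_fun_def scaleC_complex_def)
  ultimately have "R \<in> bounded_ops UNIV norm M (lp_norm p)"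
    unfolding bounded_ops_def using R_lp(2) by auto
  moreover have "(\<lambda>n. evaluation (x n)) \<in> lp p"
    by (rule lp_mono(1)[OF p x, of _ 1]) (auto simp: norm_evaluation_le)
  ultimately have R: "R \<in> quasi_p_nuclear_ops p M (lp_norm p)"
    unfolding quasi_p_nuclear_ops_def
    by (auto simp: evaluation_apply R_def lp_norm_def intro!: bexI[of _ "\<lambda>n. evaluation (x n)"])
  have "Hinf_norm U (S m) \<le> lp_norm p m" if "m \<in> lp p" for m
    unfolding Hinf_norm_def using S_bound[OF that] lp_norm_nonneg by (intro cSup_least) auto
  then have S: "S \<in> bounded_ops M (lp_norm p) (Hinf U) (Hinf_norm U)"
    unfolding bounded_ops_def using S_add S_scale by (auto simp: M_def intro!: exI[of _ 1])
  show ?thesis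
    by (intro exI[of _ M] exI[of _ R] exI[of _ S] conjI M closed R S) (simp add: fun_eq_iff SR)
qed

section \<open>Norming functionals and Helly's theorem\<close>

text \<open>Extension of \<open>c v \<mapsto> c q(v)\<close> from the line through \<open>v\<close>.\<close>
lemma hahn_banach_norming:
  fixes q :: "'v::complex_vector \<Rightarrow> real"
  assumes q_add: "\<And>x y. q (x + y) \<le> q x + q y" and q_scale: "\<And>c x. q (c *\<^sub>C x) = cmod c * q x"
  obtains L where "\<And>x y. L (x + y) = L x + L y" "\<And>c x. L (c *\<^sub>C x) = c * L x"
    "\<And>x. cmod (L x) \<le> q x" "L v = of_real (q v)"
proof -
  define W where "W = range (\<lambda>c. c *\<^sub>C v)"
  define l where "l = (\<lambda>w. (SOME c. w = c *\<^sub>C v) * of_real (q v))"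
  have l: "l (c *\<^sub>C v) = c * of_real (q v)" for c
  proof -
    define d where "d = (SOME d. c *\<^sub>C v = d *\<^sub>C v)"
    have "c *\<^sub>C v = d *\<^sub>C v" unfolding d_def by (rule someI[of _ c]) simp
    then have eq: "(d - c) *\<^sub>C v = 0 *\<^sub>C v"
      by (simp only: complex_vector.scale_left_diff_distrib) simp
    have "cmod (d - c) * q v = cmod 0 * q v"
      unfolding q_scale[symmetric] by (simp only: eq)
    moreover have "l (c *\<^sub>C v) = d * of_real (q v)" by (simp only: l_def d_def)
    ultimately show ?thesis by auto
  qed
  have q0: "0 \<le> q x" for x
    using q_add[of x "(-1) *\<^sub>C x"] q_scale[of "-1" x] q_scale[of 0 x]
    by (simp add: scaleC_one complex_vector.scale_minus_left)
  obtain L where L: "\<And>x y. L (x + y) = L x + L y" "\<And>c x. L (c *\<^sub>C x) = c * L x"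
    "\<And>w. w \<in> W \<Longrightarrow> L w = l w" "\<And>x. cmod (L x) \<le> q x"
  proof (rule hahn_banach_seminorm[of UNIV W q l])
    show "complex_vector.subspace W"
    proof (rule complex_vector.subspaceI)
      show "0 \<in> W" unfolding W_def by (rule range_eqI[of _ _ 0]) simp
      show "x + y \<in> W" if "x \<in> W" "y \<in> W" for x y
        using that unfolding W_def
        by (elim rangeE) (simp only: scaleC_add_left[symmetric], rule rangeI)
      show "c *\<^sub>C x \<in> W" if "x \<in> W" for c x
        using that unfolding W_def by (elim rangeE) (simp only: scaleC_scaleC, rule rangeI)
    qed
    show "l (x + y) = l x + l y" if xy: "x \<in> W" "y \<in> W" for x y
    proof -
      obtain c d where "x = c *\<^sub>C v" "y = d *\<^sub>C v" using xy by (auto simp: W_def)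
      then show ?thesis using l[of "c + d"] by (simp add: l scaleC_add_left algebra_simps)
    qed
    show "l (c *\<^sub>C x) = c * l x" if x: "x \<in> W" for c x
    proof -
      obtain d where "x = d *\<^sub>C v" using x by (auto simp: W_def)
      then show ?thesis using l[of "c * d"] by (simp add: l)
    qed
    show "cmod (l x) \<le> q x" if "x \<in> W" for x
      using that q0[of v] by (auto simp: W_def l q_scale norm_mult)
  qed (use q_add q_scale in auto)
  have "v = 1 *\<^sub>C v" by (simp add: scaleC_one)
  then have "v \<in> W" unfolding W_def by blast
  then have "L v = of_real (q v)" using L(3) l[of 1] by (simp add: scaleC_one)
  with L that show thesis by blast
qed

lemma norm_le_if_functionals_le:
  fixes x :: "'a::complex_normed_vector"
  assumes "\<And>\<phi>. cmod (cdual_apply \<phi> x) \<le> B * norm \<phi>" and "0 \<le> B"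
  shows "norm x \<le> B"
proof -
  obtain L :: "'a \<Rightarrow> complex" where L: "\<And>x y. L (x + y) = L x + L y" "\<And>c x. L (c *\<^sub>C x) = c * L x"
    "\<And>x. cmod (L x) \<le> norm x" "L x = of_real (norm x)"
    by (rule hahn_banach_norming[of norm x]) (use norm_triangle_ineq norm_scaleC in auto)
  have C: "cdual_apply (Cdual L) = L"
    by (rule cdual_apply_Cdual[where K = 1]) (use L in auto)
  have "norm (Cdual L) \<le> 1" by (rule norm_cdual_le) (use C L in auto)
  have "norm x = cmod (cdual_apply (Cdual L) x)" using C L by simp
  also have "\<dots> \<le> B * norm (Cdual L)" by (rule assms)
  also have "\<dots> \<le> B * 1" using \<open>norm (Cdual L) \<le> 1\<close> assms by (intro mult_left_mono)
  finally show ?thesis by simp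
qed

lemma mult_cnj_sgn: "w * cnj (sgn w) = of_real (cmod w)"
proof (cases "w = 0")
  case False
  have "w * cnj (sgn w) = (w * cnj w) / of_real (cmod w)" by (simp add: sgn_eq)
  also have "\<dots> = of_real ((cmod w)\<^sup>2) / of_real (cmod w)" by (simp only: complex_norm_square)
  finally show ?thesis using False by (simp add: power2_eq_square)
qed simp

lemma norm_functional_le_if_Re_le:
  fixes y :: "'a::complex_normed_vector cdual"
  assumes c: "0 \<le> c" and le: "\<And>z. norm z \<le> c \<Longrightarrow> Re (cdual_apply y z) \<le> B"
  shows "c * norm y \<le> B"
proof (cases "c = 0")
  case True
  then show ?thesis using le[of 0] by (simp add: cdual_apply_0)
next
  case False
  then have c: "c > 0" using c by simp
  have "norm y \<le> B / c"
  proof (rule norm_cdual_le)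
    show "0 \<le> B / c" using le[of 0] c by (simp add: cdual_apply_0)
    show "cmod (cdual_apply y x) \<le> B / c * norm x" for x
    proof (cases "x = 0 \<or> cdual_apply y x = 0")
      case True
      then show ?thesis using mult_nonneg_nonneg[OF \<open>0 \<le> B / c\<close> norm_ge_zero[of x]]
        by (elim disjE) (simp_all only: cdual_apply_0 norm_zero)
    next
      case False
      define k where "k = complex_of_real (c / norm x) * cnj (sgn (cdual_apply y x))"
      have "cmod k = c / norm x"
        using False c by (simp add: k_def norm_mult norm_sgn del: of_real_divide)
      then have "norm (k *\<^sub>C x) \<le> c"
        using False by (simp add: norm_scaleC)
      then have "Re (cdual_apply y (k *\<^sub>C x)) \<le> B" by (rule le)
      moreover have "cdual_apply y (k *\<^sub>C x) = of_real (c / norm x * cmod (cdual_apply y x))"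
        by (simp add: k_def cdual_apply_scaleC mult.assoc mult_cnj_sgn[symmetric] mult.commute[of "cnj _"])
      ultimately show ?thesis using False c by (simp add: field_simps)
    qed
  qed
  then show ?thesis using c by (simp add: field_simps)
qed

text \<open>The norm of a functional on a finite \<open>\<ell>\<^sub>\<infinity>\<close>-sum with weights \<open>c\<close>: the coordinates can be chosen
  norming independently of each other.\<close>
lemma sum_norm_functional_le_if_Re_le:
  fixes y :: "'i \<Rightarrow> 'a::complex_normed_vector cdual"
  assumes "finite I" and "\<And>i. 0 \<le> c i"
    and "\<And>z. (\<And>i. i \<in> I \<Longrightarrow> norm (z i) \<le> c i) \<Longrightarrow> Re (\<Sum>i\<in>I. cdual_apply (y i) (z i)) \<le> B"
  shows "(\<Sum>i\<in>I. c i * norm (y i)) \<le> B"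
  using assms
proof (induction I arbitrary: B rule: finite_induct)
  case empty
  then show ?case by simp
next
  case (insert k I)
  have "(\<Sum>i\<in>I. c i * norm (y i)) \<le> B - Re (cdual_apply (y k) w)" if w: "norm w \<le> c k" for w
  proof (rule insert.IH)
    fix z :: "'i \<Rightarrow> 'a" assume z: "\<And>i. i \<in> I \<Longrightarrow> norm (z i) \<le> c i"
    have "Re (\<Sum>i\<in>insert k I. cdual_apply (y i) ((z(k := w)) i)) \<le> B"
      using w z by (intro insert.prems) auto
    moreover have "(\<Sum>i\<in>I. cdual_apply (y i) ((z(k := w)) i)) = (\<Sum>i\<in>I. cdual_apply (y i) (z i))"
      using insert.hyps by (intro sum.cong) auto
    ultimately show "Re (\<Sum>i\<in>I. cdual_apply (y i) (z i)) \<le> B - Re (cdual_apply (y k) w)"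
      using insert.hyps by (simp add: fun_upd_same del: Re_sum fun_upd_apply)
  qed (use insert.prems in auto)
  then have "c k * norm (y k) \<le> B - (\<Sum>i\<in>I. c i * norm (y i))"
    using insert.prems by (intro norm_functional_le_if_Re_le) (auto simp: algebra_simps)
  then show ?case using insert.hyps by simp
qed

text \<open>A version of Helly's theorem (a weak form of local reflexivity): if the vectors \<open>v j\<close> are, as
  functionals on the dual, dominated as though they differed by at most \<open>\<eta>\<close> from \<open>\<Sum>\<^sub>i b j i \<psi>\<^sub>i\<close> with
  \<open>\<psi>\<^sub>i\<close> in the bidual of norm at most \<open>c i\<close>, then vectors \<open>z i\<close> of the space itself can take the place of the \<open>\<psi>\<^sub>i\<close>. The proof
  separates \<open>v\<close> from the tuples \<open>\<Sum>\<^sub>i b j i z\<^sub>i + r\<^sub>j\<close> with \<open>\<parallel>z\<^sub>i\<parallel> \<le> c i\<close> and \<open>\<parallel>r\<^sub>j\<parallel> \<le> \<eta>\<close>: a functional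
  on tuples splits into coordinates \<open>y j\<close>, and if it is bounded by \<open>1\<close> on this convex set, then the
  hypothesis bounds it by \<open>1\<close> at \<open>v\<close>. The factors \<open>2\<close> absorb that the gauge need not be attained.\<close>
lemma helly_approximation:
  fixes v :: "'j \<Rightarrow> 'a::complex_normed_vector" and b :: "'j \<Rightarrow> 'i \<Rightarrow> complex"
  assumes fin: "finite A" "finite I" and c: "\<And>i. 0 \<le> c i" and \<eta>: "0 < \<eta>"
    and dom: "\<And>y. cmod (\<Sum>j\<in>A. cdual_apply (y j) (v j)) \<le>
      (\<Sum>i\<in>I. c i * norm (\<Sum>j\<in>A. b j i *\<^sub>C y j)) + (\<Sum>j\<in>A. \<eta> * norm (y j))"
  obtains z where "\<And>i. i \<in> I \<Longrightarrow> norm (z i) \<le> 2 * c i"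
    and "\<And>j. j \<in> A \<Longrightarrow> norm (v j - (\<Sum>i\<in>I. b j i *\<^sub>C z i)) \<le> 2 * \<eta>"
proof -
  \<comment> \<open>\<open>g\<close> is the gauge of the convex set of admissible tuples\<close>
  define T where "T = (\<lambda>u::'j \<Rightarrow> 'a. {t. 0 < t \<and> (\<exists>z. (\<forall>i\<in>I. norm (z i) \<le> t * c i) \<and>
      (\<forall>j\<in>A. norm (u j - (\<Sum>i\<in>I. b j i *\<^sub>C z i)) \<le> t * \<eta>))})"
  define g where "g = (\<lambda>u. Inf (T u))"
  have T_zero: "t \<in> T u" if "0 < t" "\<And>j. j \<in> A \<Longrightarrow> norm (u j) \<le> t * \<eta>" for t u
    using that c by (auto simp: T_def intro!: exI[of _ "\<lambda>_. 0"])
  have T_ne: "T u \<noteq> {}" for u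
  proof -
    let ?t = "(\<Sum>j\<in>A. norm (u j)) / \<eta> + 1"
    have "?t > 0" using \<eta> by (intro add_nonneg_pos divide_nonneg_pos sum_nonneg) auto
    moreover have "norm (u j) \<le> ?t * \<eta>" if "j \<in> A" for j
      using member_le_sum[of j A "\<lambda>j. norm (u j)"] that fin \<eta> by (simp add: distrib_right)
    ultimately have "?t \<in> T u" by (rule T_zero)
    then show ?thesis by blast
  qed
  have bdd: "bdd_below (T u)" for u by (auto simp: T_def bdd_below_def intro!: exI[of _ 0])
  have g_le: "g u \<le> t" if "t \<in> T u" for u t unfolding g_def by (rule cInf_lower[OF that bdd])
  have g_less: "\<exists>t\<in>T u. t < s" if "g u < s" for u s
    using that unfolding g_def by (simp add: cInf_less_iff[OF T_ne bdd])
  have g0: "0 \<le> g u" for u unfolding g_def by (rule cInf_greatest[OF T_ne]) (simp add: T_def)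
  have g_add: "g (u + u') \<le> g u + g u'" for u u'
  proof (rule field_le_epsilon)
    fix e :: real assume "e > 0"
    then obtain t t' where t: "t \<in> T u" "t < g u + e / 2" "t' \<in> T u'" "t' < g u' + e / 2"
      using g_less[of u "g u + e / 2"] g_less[of u' "g u' + e / 2"] by auto
    obtain z z' where z: "\<forall>i\<in>I. norm (z i) \<le> t * c i" "\<forall>j\<in>A. norm (u j - (\<Sum>i\<in>I. b j i *\<^sub>C z i)) \<le> t * \<eta>"
      "\<forall>i\<in>I. norm (z' i) \<le> t' * c i" "\<forall>j\<in>A. norm (u' j - (\<Sum>i\<in>I. b j i *\<^sub>C z' i)) \<le> t' * \<eta>"
      using t by (auto simp: T_def)
    have "t + t' \<in> T (u + u')"
      unfolding T_def
    proof (intro CollectI conjI exI[of _ "\<lambda>i. z i + z' i"] ballI)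
      show "0 < t + t'" using t by (simp add: T_def)
      show "norm (z i + z' i) \<le> (t + t') * c i" if "i \<in> I" for i
        using z that by (intro order_trans[OF norm_triangle_ineq]) (simp add: distrib_right add_mono)
      show "norm ((u + u') j - (\<Sum>i\<in>I. b j i *\<^sub>C (z i + z' i))) \<le> (t + t') * \<eta>" if "j \<in> A" for j
      proof -
        have "(u + u') j - (\<Sum>i\<in>I. b j i *\<^sub>C (z i + z' i)) =
            (u j - (\<Sum>i\<in>I. b j i *\<^sub>C z i)) + (u' j - (\<Sum>i\<in>I. b j i *\<^sub>C z' i))"
          by (simp add: scaleC_add_right sum.distrib)
        also have "norm \<dots> \<le> t * \<eta> + t' * \<eta>"
          using z that by (intro order_trans[OF norm_triangle_ineq] add_mono) auto
        finally show ?thesis by (simp add: distrib_right)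
      qed
    qed
    then show "g (u + u') \<le> g u + g u' + e" using g_le t by fastforce
  qed
  have g_scale_le: "g (k *\<^sub>C u) \<le> cmod k * g u" if k: "k \<noteq> 0" for k u
  proof (rule field_le_epsilon)
    fix e :: real assume "e > 0"
    then have "g u < g u + e / cmod k" using k by simp
    then obtain t where t: "t \<in> T u" "t < g u + e / cmod k" using g_less by blast
    obtain z where z: "\<forall>i\<in>I. norm (z i) \<le> t * c i" "\<forall>j\<in>A. norm (u j - (\<Sum>i\<in>I. b j i *\<^sub>C z i)) \<le> t * \<eta>"
      using t by (auto simp: T_def)
    have "cmod k * t \<in> T (k *\<^sub>C u)"
      unfolding T_def
    proof (intro CollectI conjI exI[of _ "\<lambda>i. k *\<^sub>C z i"] ballI)
      show "0 < cmod k * t" using t k by (simp add: T_def)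
      show "norm (k *\<^sub>C z i) \<le> cmod k * t * c i" if "i \<in> I" for i
        using z that by (simp add: norm_scaleC mult.assoc mult_left_mono)
      show "norm ((k *\<^sub>C u) j - (\<Sum>i\<in>I. b j i *\<^sub>C k *\<^sub>C z i)) \<le> cmod k * t * \<eta>" if "j \<in> A" for j
      proof -
        have "(k *\<^sub>C u) j - (\<Sum>i\<in>I. b j i *\<^sub>C k *\<^sub>C z i) = k *\<^sub>C (u j - (\<Sum>i\<in>I. b j i *\<^sub>C z i))"
          by (simp add: scaleC_fun_def complex_vector.scale_right_diff_distrib complex_vector.scale_sum_right mult.commute)
        then show ?thesis using z that by (simp add: norm_scaleC mult.assoc mult_left_mono)
      qed
    qed
    then have "g (k *\<^sub>C u) \<le> cmod k * t" by (rule g_le)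
    also have "\<dots> \<le> cmod k * (g u + e / cmod k)" using t by (intro mult_left_mono) auto
    also have "\<dots> = cmod k * g u + e" using k by (simp add: distrib_left)
    finally show "g (k *\<^sub>C u) \<le> cmod k * g u + e" .
  qed
  have g_scale: "g (k *\<^sub>C u) = cmod k * g u" for k u
  proof (cases "k = 0")
    case True
    have "g 0 \<le> 0"
    proof (rule field_le_epsilon)
      show "g 0 \<le> 0 + e" if "e > 0" for e
        using that \<eta> by (intro g_le T_zero) auto
    qed
    then show ?thesis using True g0[of 0] by simp
  next
    case False
    have "g u \<le> cmod (inverse k) * g (k *\<^sub>C u)"
      using g_scale_le[of "inverse k" "k *\<^sub>C u"] False by (simp add: scaleC_one)
    then have "cmod k * g u \<le> g (k *\<^sub>C u)"
      using False by (simp add: norm_inverse norm_divide field_simps)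
    then show ?thesis using g_scale_le[OF False, of u] by simp
  qed
  define v' where "v' = (\<lambda>j. if j \<in> A then v j else 0)"
  obtain L where L: "\<And>u u'. L (u + u') = L u + L u'" "\<And>k u. L (k *\<^sub>C u) = k * L u"
    "\<And>u. cmod (L u) \<le> g u" "L v' = of_real (g v')"
    using hahn_banach_norming[of g v', OF g_add g_scale] by blast
  have L0: "L 0 = 0" using L(2)[of 0 0] by simp
  define single where "single = (\<lambda>(j::'j) (w::'a) (k::'j). if k = j then w else 0)"
  define y where "y = (\<lambda>j. Cdual (\<lambda>w. L (single j w)))"
  have y: "cdual_apply (y j) w = L (single j w)" for j w
    unfolding y_def
  proof (subst cdual_apply_Cdual[where K = "1 / \<eta>"])
    show "L (single j (x + x')) = L (single j x) + L (single j x')" for x x'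
      unfolding L(1)[symmetric] by (rule arg_cong[of _ _ L]) (auto simp: single_def)
    show "L (single j (k *\<^sub>C x)) = k * L (single j x)" for k x
      unfolding L(2)[symmetric] by (rule arg_cong[of _ _ L]) (auto simp: single_def scaleC_fun_def)
    show "cmod (L (single j x)) \<le> 1 / \<eta> * norm x" for x
    proof (cases "x = 0")
      case True
      then have "single j x = 0" by (auto simp: single_def)
      then show ?thesis using True L0 by simp
    next
      case False
      have "g (single j x) \<le> norm x / \<eta>"
        using False \<eta> by (intro g_le T_zero) (auto simp: single_def)
      then show ?thesis using L(3)[of "single j x"] by simp
    qed
  qed simp
  have L_sum: "L (\<lambda>j. if j \<in> B then u j else 0) = (\<Sum>j\<in>B. cdual_apply (y j) (u j))" if "finite B" for B u
    using that
  proof induction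
    case empty
    then show ?case using L0 by (simp add: zero_fun_def)
  next
    case (insert k B)
    have "(\<lambda>j. if j \<in> insert k B then u j else 0) = single k (u k) + (\<lambda>j. if j \<in> B then u j else 0)"
      using insert.hyps by (auto simp: single_def)
    then show ?case using insert by (simp add: L(1) y)
  qed
  let ?Y = "\<lambda>i. \<Sum>j\<in>A. b j i *\<^sub>C y j"
  have Re_le: "Re (\<Sum>i\<in>I. cdual_apply (?Y i) (z i)) + Re (\<Sum>j\<in>A. cdual_apply (y j) (r j)) \<le> 1"
    if z: "\<And>i. i \<in> I \<Longrightarrow> norm (z i) \<le> c i" and r: "\<And>j. j \<in> A \<Longrightarrow> norm (r j) \<le> \<eta>" for z r
  proof -
    define u where "u = (\<lambda>j. (\<Sum>i\<in>I. b j i *\<^sub>C z i) + r j)"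
    have "1 \<in> T (\<lambda>j. if j \<in> A then u j else 0)"
      using z r by (auto simp: T_def u_def intro!: exI[of _ z])
    then have "cmod (L (\<lambda>j. if j \<in> A then u j else 0)) \<le> 1"
      using L(3) g_le order_trans by blast
    moreover have "(\<Sum>j\<in>A. cdual_apply (y j) (u j)) =
        (\<Sum>i\<in>I. cdual_apply (?Y i) (z i)) + (\<Sum>j\<in>A. cdual_apply (y j) (r j))"
      by (simp add: u_def cdual_apply_simps sum_cdual_apply sum.distrib sum_distrib_left)
         (rule sum.swap)
    ultimately show ?thesis
      using L_sum[OF fin(1), of u] complex_Re_le_cmod[of "\<Sum>j\<in>A. cdual_apply (y j) (u j)"] by simp
  qed
  have "(\<Sum>i\<in>I. c i * norm (?Y i)) \<le> 1 - Re (\<Sum>j\<in>A. cdual_apply (y j) (r j))"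
    if r: "\<And>j. j \<in> A \<Longrightarrow> norm (r j) \<le> \<eta>" for r
    by (rule sum_norm_functional_le_if_Re_le[OF fin(2) c]) (use Re_le[of _ r] r in \<open>force\<close>)
  then have "(\<Sum>j\<in>A. \<eta> * norm (y j)) \<le> 1 - (\<Sum>i\<in>I. c i * norm (?Y i))"
    by (intro sum_norm_functional_le_if_Re_le[OF fin(1)]) (use \<eta> in \<open>force\<close>)+
  then have "cmod (L v') \<le> 1"
    using dom[of y] L_sum[OF fin(1), of v] by (simp add: v'_def)
  then have "g v' < 2" using L(4) g0[of v'] by simp
  then obtain t where t: "t \<in> T v'" "t < 2" using g_less by blast
  then obtain z where z: "\<forall>i\<in>I. norm (z i) \<le> t * c i" "\<forall>j\<in>A. norm (v' j - (\<Sum>i\<in>I. b j i *\<^sub>C z i)) \<le> t * \<eta>"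
    by (auto simp: T_def)
  have "t * c i \<le> 2 * c i" "t * \<eta> \<le> 2 * \<eta>" for i using t c[of i] \<eta> by (auto intro: mult_right_mono)
  then show thesis
    using z by (intro that[of z]) (fastforce simp: v'_def intro: order_trans)+
qed

section \<open>Sets dominated by a \<open>p\<close>-summable sequence in the bidual\<close>

text \<open>The part of the \<open>p\<close>-convex hull of the bidual sequence \<open>\<psi>\<close> (with coefficients from the full dual
  ball) that lies in the space itself.\<close>
definition bidual_hull :: "real \<Rightarrow> (nat \<Rightarrow> 'a::complex_normed_vector cdual cdual) \<Rightarrow> 'a set" where
  "bidual_hull p \<psi> =
     {x. \<exists>b\<in>dual_ball p. \<forall>y. (\<lambda>n. b n * cdual_apply (\<psi> n) y) sums cdual_apply y x}"

lemma lp_finite_support: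
  fixes x :: "nat \<Rightarrow> 'a::real_normed_vector"
  assumes p: "p \<ge> 1" and I: "finite I" and x: "\<And>n. n \<notin> I \<Longrightarrow> x n = 0"
  shows "x \<in> lp p" "lp_norm p x = (\<Sum>n\<in>I. norm (x n) powr p) powr (1 / p)"
proof -
  have s: "(\<lambda>n. norm (x n) powr p) sums (\<Sum>n\<in>I. norm (x n) powr p)"
    by (rule sums_finite[OF I]) (use x p in auto)
  then show "x \<in> lp p" "lp_norm p x = (\<Sum>n\<in>I. norm (x n) powr p) powr (1 / p)"
    by (auto simp: lp_def lp_norm_def sums_iff)
qed

lemma lp_norm_functionals:
  assumes p: "p \<ge> 1" and \<psi>: "\<psi> \<in> lp p"
  shows "(\<lambda>n. cdual_apply (\<psi> n) y) \<in> lp p"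
    and "lp_norm p (\<lambda>n. cdual_apply (\<psi> n) y) \<le> norm y * lp_norm p \<psi>"
proof -
  have "cmod (cdual_apply (\<psi> n) y) \<le> norm y * norm (\<psi> n)" for n
    by (subst mult.commute) (rule cmod_cdual_apply_le)
  from lp_mono[OF p \<psi> this norm_ge_zero]
  show "(\<lambda>n. cdual_apply (\<psi> n) y) \<in> lp p"
    and "lp_norm p (\<lambda>n. cdual_apply (\<psi> n) y) \<le> norm y * lp_norm p \<psi>" .
qed

text \<open>Functionals on \<open>\<ell>\<^sub>p\<close> are given by sequences in the dual ball, because truncations converge in norm.\<close>
lemma lp_functional_representation:
  fixes L :: "(nat \<Rightarrow> complex) \<Rightarrow> complex"
  assumes p: "p \<ge> 1"
    and add: "\<And>u v. u \<in> lp p \<Longrightarrow> v \<in> lp p \<Longrightarrow> L (u + v) = L u + L v"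
    and scale: "\<And>c u. u \<in> lp p \<Longrightarrow> L (c *\<^sub>C u) = c * L u"
    and le: "\<And>u. u \<in> lp p \<Longrightarrow> cmod (L u) \<le> lp_norm p u"
  obtains a where "a \<in> dual_ball p" "\<And>u. u \<in> lp p \<Longrightarrow> (\<lambda>n. a n * u n) sums L u"
proof -
  define unit where "unit = (\<lambda>(k::nat) n. if n = k then 1 else (0::complex))"
  define a where "a = (\<lambda>k. L (unit k))"
  have unit: "unit k \<in> lp p" for k
    by (rule lp_finite_support(1)[OF p, of "{k}"]) (auto simp: unit_def)
  have cut: "(\<lambda>n. if n \<in> I then u n else 0) \<in> lp p \<and>
      L (\<lambda>n. if n \<in> I then u n else 0) = (\<Sum>n\<in>I. a n * u n)" if "finite I" for I u
    using that
  proof (induction I rule: finite_induct)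
    case empty
    have "(0 :: nat \<Rightarrow> complex) \<in> lp p" by (simp add: lp_def)
    then show ?case using scale[of 0 0] by (simp add: zero_fun_def scaleC_fun_def)
  next
    case (insert k I)
    have eq: "(\<lambda>n. if n \<in> insert k I then u n else 0) = u k *\<^sub>C unit k + (\<lambda>n. if n \<in> I then u n else 0)"
      using insert.hyps by (auto simp: unit_def scaleC_fun_def scaleC_complex_def)
    show ?case
      unfolding eq using insert unit lp_scaleC(1)[OF p unit] minkowski_lp(1)[OF p, where 'a = complex]
      by (simp add: add scale a_def)
  qed
  have "a \<in> dual_ball p"
    unfolding dual_ball_def
  proof (intro CollectI allI impI)
    fix I :: "nat set" and x :: "nat \<Rightarrow> real" assume I: "finite I" and x: "\<forall>i. 0 \<le> x i"
    \<comment> \<open>test \<open>L\<close> on the vector with moduli \<open>x\<close> whose phases cancel those of \<open>a\<close>\<close>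
    define u where "u = (\<lambda>n. if n \<in> I then of_real (x n) * cnj (sgn (a n)) else 0)"
    have u: "u \<in> lp p" "L u = (\<Sum>n\<in>I. a n * (of_real (x n) * cnj (sgn (a n))))"
      using cut[OF I] by (auto simp: u_def)
    have "L u = (\<Sum>n\<in>I. of_real (cmod (a n) * x n))"
      unfolding u(2) by (intro sum.cong refl) (simp add: mult_cnj_sgn[symmetric])
    then have "L u = of_real (\<Sum>n\<in>I. cmod (a n) * x n)" by simp
    then have "(\<Sum>n\<in>I. cmod (a n) * x n) = cmod (L u)"
      using x by (simp only: norm_of_real) (simp add: sum_nonneg)
    also have "\<dots> \<le> lp_norm p u" by (rule le[OF u(1)])
    also have "\<dots> = (\<Sum>n\<in>I. cmod (u n) powr p) powr (1 / p)"
      by (rule lp_finite_support(2)[OF p I]) (simp add: u_def)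
    also have "\<dots> \<le> (\<Sum>n\<in>I. x n powr p) powr (1 / p)"
      using p x by (intro powr_mono2 sum_mono) (auto simp: u_def norm_mult norm_sgn intro: sum_nonneg)
    finally show "(\<Sum>n\<in>I. cmod (a n) * x n) \<le> (\<Sum>n\<in>I. x n powr p) powr (1 / p)" .
  qed
  moreover have "(\<lambda>n. a n * u n) sums L u" if u: "u \<in> lp p" for u
  proof -
    have "(\<lambda>N. L u - (\<Sum>n<N. a n * u n)) \<longlonglongrightarrow> 0"
    proof (rule tendsto_rabs_zero_cancel[OF _] | rule Lim_null_comparison[OF _ lp_tail_tendsto_0[OF p u]])+
      have "cmod (L u - (\<Sum>n<N. a n * u n)) \<le> lp_norm p (\<lambda>n. if n < N then 0 else u n)" for N
      proof -
        let ?h = "\<lambda>n. if n \<in> {..<N} then u n else 0" and ?t = "\<lambda>n. if n < N then 0 else u n"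
        have t: "?t \<in> lp p" by (rule lp_mono(1)[OF p u, of _ 1]) auto
        have "u = ?h + ?t" by auto
        then have "L u = L ?h + L ?t"
          using add[of ?h ?t] cut[of "{..<N}" u] t by simp
        then have "L u - (\<Sum>n<N. a n * u n) = L ?t" using cut[of "{..<N}" u] by simp
        then show ?thesis using le[OF t] by simp
      qed
      then show "\<forall>\<^sub>F N in sequentially. norm (L u - (\<Sum>n<N. a n * u n)) \<le> lp_norm p (\<lambda>n. if n < N then 0 else u n)"
        by (intro always_eventually allI)
    qed
    from tendsto_diff[OF tendsto_const[of "L u"] this] show ?thesis by (simp add: sums_def)
  qed
  ultimately show thesis by (rule that)
qed

text \<open>The functional \<open>(\<psi>\<^sub>n(y))\<^sub>n \<mapsto> y(x)\<close> is well defined and contractive on a subspace of \<open>\<ell>\<^sub>p\<close>; its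
  Hahn--Banach extension is represented by the coefficients sought.\<close>
lemma bidual_hull_if_dominated:
  assumes p: "p \<ge> 1" and \<psi>: "\<psi> \<in> lp p"
    and dom: "\<And>y. cmod (cdual_apply y x) \<le> lp_norm p (\<lambda>n. cdual_apply (\<psi> n) y)"
  shows "x \<in> bidual_hull p \<psi>"
proof -
  define ev where "ev = (\<lambda>y n. cdual_apply (\<psi> n) y)"
  have ev_lp: "ev y \<in> lp p" for y unfolding ev_def by (rule lp_norm_functionals[OF p \<psi>])
  have ev_add: "ev (y + z) = ev y + ev z" and ev_scale: "ev (c *\<^sub>C y) = c *\<^sub>C ev y"
    and ev_diff: "ev (y - z) = ev y - ev z" for y z c
    by (simp_all add: ev_def fun_eq_iff cdual_apply_simps scaleC_fun_def scaleC_complex_def)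
  define l where "l = (\<lambda>u. cdual_apply (SOME y. u = ev y) x)"
  have l: "l (ev y) = cdual_apply y x" for y
  proof -
    define z where "z = (SOME z. ev y = ev z)"
    have "ev y = ev z" unfolding z_def by (rule someI[of _ y]) simp
    then have "ev (y - z) = 0" by (simp add: ev_diff)
    moreover have "cmod (cdual_apply (y - z) x) \<le> lp_norm p (ev (y - z))"
      using dom[of "y - z"] by (simp only: ev_def)
    ultimately have "cdual_apply y x = cdual_apply z x"
      using p by (simp add: lp_norm_def cdual_apply_simps)
    then show ?thesis by (simp add: l_def z_def)
  qed
  obtain L where L: "\<And>u v. u \<in> lp p \<Longrightarrow> v \<in> lp p \<Longrightarrow> L (u + v) = L u + L v"
    "\<And>c u. u \<in> lp p \<Longrightarrow> L (c *\<^sub>C u) = c * L u"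
    "\<And>u. u \<in> range ev \<Longrightarrow> L u = l u" "\<And>u. u \<in> lp p \<Longrightarrow> cmod (L u) \<le> lp_norm p u"
  proof (rule hahn_banach_seminorm[OF lp_subspace[OF p], of "range ev" "lp_norm p" l])
    show "complex_vector.subspace (range ev)"
    proof (rule complex_vector.subspaceI)
      show "0 \<in> range ev" by (rule range_eqI[of _ _ 0]) (simp add: ev_def fun_eq_iff cdual_apply_simps)
      show "u + v \<in> range ev" if "u \<in> range ev" "v \<in> range ev" for u v
        using that by (elim rangeE) (simp only: ev_add[symmetric] rangeI)
      show "c *\<^sub>C u \<in> range ev" if "u \<in> range ev" for c u
        using that by (elim rangeE) (simp only: ev_scale[symmetric] rangeI)
    qed
    show "range ev \<subseteq> lp p" using ev_lp by auto
    show "l (u + v) = l u + l v" if "u \<in> range ev" "v \<in> range ev" for u v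
      using that by (elim rangeE) (simp add: ev_add[symmetric] l cdual_apply_simps)
    show "l (c *\<^sub>C u) = c * l u" if "u \<in> range ev" for c u
      using that by (elim rangeE) (simp add: ev_scale[symmetric] l cdual_apply_simps)
    show "cmod (l u) \<le> lp_norm p u" if "u \<in> range ev" for u
    proof -
      obtain y where "u = ev y" using \<open>u \<in> range ev\<close> by blast
      then show ?thesis using dom[of y] l[of y] by (simp add: ev_def)
    qed
  qed (use minkowski_lp(2)[OF p] lp_scaleC(2)[OF p] in auto)
  obtain a where a: "a \<in> dual_ball p" "\<And>u. u \<in> lp p \<Longrightarrow> (\<lambda>n. a n * u n) sums L u"
    using lp_functional_representation[of p L, OF p L(1,2,4)] by blast
  have "(\<lambda>n. a n * cdual_apply (\<psi> n) y) sums cdual_apply y x" for y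
    using a(2)[OF ev_lp[of y]] L(3)[of "ev y"] l[of y] by (simp add: ev_def)
  then show ?thesis using a(1) by (auto simp: bidual_hull_def)
qed

lemma bidual_hull_norm_le:
  assumes p: "p \<ge> 1" and \<psi>: "\<psi> \<in> lp p" and x: "x \<in> bidual_hull p \<psi>"
  shows "norm x \<le> lp_norm p \<psi>"
proof (rule norm_le_if_functionals_le)
  fix y
  obtain b where b: "b \<in> dual_ball p" "(\<lambda>n. b n * cdual_apply (\<psi> n) y) sums cdual_apply y x"
    using x by (auto simp: bidual_hull_def)
  have "cmod (cdual_apply y x) \<le> lp_norm p (\<lambda>n. cdual_apply (\<psi> n) y)"
    using dual_ball_complex_pairing(2)[OF p b(1) lp_norm_functionals(1)[OF p \<psi>, of y]] b(2) by (simp add: sums_iff)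
  also have "\<dots> \<le> lp_norm p \<psi> * norm y"
    using lp_norm_functionals(2)[OF p \<psi>, of y] by (simp add: mult.commute)
  finally show "cmod (cdual_apply y x) \<le> lp_norm p \<psi> * norm y" .
qed (rule lp_norm_nonneg)

text \<open>Up to a finite set, a hull is contained in the hull of an arbitrarily small sequence. On the
  first \<open>N\<close> coordinates the coefficients form a totally bounded set, so a finite set \<open>A\<close> of points
  suffices for the leading coefficients of \<open>x - v\<close> to be tiny; these small coefficients
  are traded for small vectors. On the remaining coordinates the vectors are small already.\<close>
lemma bidual_hull_finite_cover:
  assumes p: "p \<ge> 1" and \<psi>: "\<psi> \<in> lp p" and \<epsilon>: "0 < \<epsilon>"
  obtains A \<psi>' where "finite A" "A \<subseteq> bidual_hull p \<psi>" "\<psi>' \<in> lp p" "lp_norm p \<psi>' \<le> \<epsilon>"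
    and "\<And>x. x \<in> bidual_hull p \<psi> \<Longrightarrow> \<exists>v\<in>A. x - v \<in> bidual_hull p \<psi>'"
proof -
  define H where "H = bidual_hull p \<psi>"
  have "\<forall>x\<in>H. \<exists>b. b \<in> dual_ball p \<and> (\<forall>y. (\<lambda>n. b n * cdual_apply (\<psi> n) y) sums cdual_apply y x)"
    by (auto simp: H_def bidual_hull_def)
  then obtain b where b: "\<And>x. x \<in> H \<Longrightarrow> b x \<in> dual_ball p"
    and b_sums: "\<And>x y. x \<in> H \<Longrightarrow> (\<lambda>n. b x n * cdual_apply (\<psi> n) y) sums cdual_apply y x"
    by metis
  have b_le: "cmod (b x n) \<le> 1" if "x \<in> H" for x n
    using dual_ballD[OF b[OF that], of "{n}" "\<lambda>_. 1"] by simp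
  define tail where "tail = (\<lambda>N n. if n < N then 0 else \<psi> n)"
  have tail_lp: "tail N \<in> lp p" for N
    unfolding tail_def by (rule lp_mono(1)[OF p \<psi>, of _ 1]) auto
  have "(\<lambda>N. lp_norm p (tail N)) \<longlonglongrightarrow> 0" unfolding tail_def by (rule lp_tail_tendsto_0[OF p \<psi>])
  then have "\<forall>\<^sub>F N in sequentially. lp_norm p (tail N) < \<epsilon> / 8"
    by (rule order_tendstoD) (use \<epsilon> in simp)
  then obtain N where N: "lp_norm p (tail N) < \<epsilon> / 8"
    using eventually_happens trivial_limit_sequentially by blast
  define \<delta> where "\<delta> = \<epsilon> / (4 * (lp_norm p \<psi> + 1))"
  have nn: "lp_norm p \<psi> + 1 > 0" using lp_norm_nonneg[of p \<psi>] by simp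
  have \<delta>: "\<delta> > 0" "2 * \<delta> * lp_norm p \<psi> \<le> \<epsilon> / 2"
    using \<epsilon> nn by (auto simp: \<delta>_def field_simps)
  \<comment> \<open>half of the dual ball is reserved for the leading coefficients of a difference, divided by \<open>\<delta>\<close>,
    and half for the difference itself, which lies in twice the dual ball\<close>
  define \<psi>' where "\<psi>' = (\<lambda>n. if n < N then complex_of_real (2 * \<delta>) *\<^sub>C \<psi> n else 4 *\<^sub>C \<psi> n)"
  have \<psi>': "\<psi>' \<in> lp p" "lp_norm p \<psi>' \<le> \<epsilon>"
  proof -
    define h where "h = (\<lambda>n. if n < N then complex_of_real (2 * \<delta>) *\<^sub>C \<psi> n else 0)"
    have h: "h \<in> lp p" "lp_norm p h \<le> 2 * \<delta> * lp_norm p \<psi>"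
      using lp_mono[OF p \<psi>, of h "2 * \<delta>"] \<delta> by (simp_all add: h_def norm_scaleC)
    have "\<psi>' = h + 4 *\<^sub>C tail N"
      by (auto simp: \<psi>'_def h_def tail_def scaleC_fun_def)
    then show "\<psi>' \<in> lp p" "lp_norm p \<psi>' \<le> \<epsilon>"
      using minkowski_lp[OF p h(1) lp_scaleC(1)[OF p tail_lp, of 4 N]] h(2) \<delta>(2) N
        lp_scaleC(2)[OF p tail_lp, of 4 N] by auto
  qed
  \<comment> \<open>two points with the same key have nearby leading coefficients\<close>
  define g where "g = \<delta> / (2 * (real N + 1))"
  have g: "g > 0" "real N * (2 * g) \<le> \<delta>" using \<delta> by (auto simp: g_def field_simps)
  define key where "key = (\<lambda>x. restrict (\<lambda>n. (\<lfloor>Re (b x n) / g\<rfloor>, \<lfloor>Im (b x n) / g\<rfloor>)) {..<N})"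
  define m where "m = \<lfloor>1 / g\<rfloor> + 1"
  have "key ` H \<subseteq> PiE {..<N} (\<lambda>_. {-m..m} \<times> {-m..m})"
  proof (intro image_subsetI PiE_I)
    fix x n assume x: "x \<in> H" and n: "n \<in> {..<N}"
    have "\<lfloor>r / g\<rfloor> \<in> {-m..m}" if "\<bar>r\<bar> \<le> 1" for r
    proof -
      have "r / g \<le> 1 / g" "- (1 / g) \<le> r / g" using that g by (auto simp: field_simps)
      then show ?thesis unfolding m_def by (simp, linarith)
    qed
    then show "key x n \<in> {-m..m} \<times> {-m..m}"
      using n b_le[OF x, of n] abs_Re_le_cmod[of "b x n"] abs_Im_le_cmod[of "b x n"]
      by (force simp: key_def)
  qed (auto simp: key_def)
  then have fin: "finite (key ` H)"
    by (rule finite_subset) (auto intro: finite_PiE)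
  define A where "A = inv_into H key ` (key ` H)"
  show thesis
  proof (rule that[of A \<psi>'])
    show "finite A" using fin by (simp add: A_def)
    show "A \<subseteq> bidual_hull p \<psi>" using inv_into_into[of _ key H] by (auto simp: A_def H_def)
    fix x assume "x \<in> bidual_hull p \<psi>"
    then have x: "x \<in> H" by (simp add: H_def)
    define v where "v = inv_into H key (key x)"
    have v: "v \<in> H" "key v = key x" "v \<in> A"
      using x by (auto simp: v_def A_def inv_into_into f_inv_into_f)
    define c where "c = (\<lambda>n. b x n - b v n)"
    have c_le: "cmod (c n) \<le> 2 * g" if "n < N" for n
    proof -
      have fl: "\<bar>r - s\<bar> \<le> g" if "\<lfloor>r / g\<rfloor> = \<lfloor>s / g\<rfloor>" for r s
      proof -
        have "\<bar>r / g - s / g\<bar> \<le> 1" using that by linarith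
        then show ?thesis using g by (simp add: diff_divide_distrib[symmetric])
      qed
      have "key v n = key x n" using v by simp
      then have "\<bar>Re (c n)\<bar> \<le> g" "\<bar>Im (c n)\<bar> \<le> g"
        using that by (auto simp: key_def c_def intro!: fl)
      then show ?thesis using cmod_le[of "c n"] by simp
    qed
    define a where "a = (\<lambda>n. if n < N then c n / of_real \<delta> else 0)"
    have a: "a \<in> dual_ball p"
    proof (rule dual_ball_l1[OF p, of "{..<N}"])
      have "(\<Sum>n<N. cmod (a n)) \<le> (\<Sum>n<N. 2 * g / \<delta>)"
        using c_le \<delta> by (intro sum_mono) (auto simp: a_def norm_divide divide_right_mono)
      also have "\<dots> \<le> 1" using g \<delta> by (simp add: field_simps)
      finally show "(\<Sum>n<N. cmod (a n)) \<le> 1" .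
    qed (auto simp: a_def)
    have c: "(\<lambda>n. c n / 2) \<in> dual_ball p"
    proof (rule dual_ball_dominated[OF b[OF x] b[OF v(1)], of _ "1/2" "1/2"])
      show "cmod (c n / 2) \<le> 1 / 2 * cmod (b x n) + 1 / 2 * cmod (b v n)" for n
        using norm_triangle_ineq4[of "b x n" "b v n"] by (simp add: c_def norm_divide)
    qed auto
    define d where "d = (\<lambda>n. if n < N then c n / of_real (2 * \<delta>) else c n / 4)"
    have "d \<in> dual_ball p"
      by (rule dual_ball_dominated[OF a c, of _ "1/2" "1/2"])
         (use \<delta> in \<open>auto simp: d_def a_def norm_divide norm_mult mult.commute\<close>)
    moreover have "(\<lambda>n. d n * cdual_apply (\<psi>' n) y) sums cdual_apply y (x - v)" for y
    proof -
      have "d n * cdual_apply (\<psi>' n) y = b x n * cdual_apply (\<psi> n) y - b v n * cdual_apply (\<psi> n) y" for n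
      proof -
        have "d n * cdual_apply (\<psi>' n) y = c n * cdual_apply (\<psi> n) y"
          using \<delta> by (simp add: d_def \<psi>'_def cdual_apply_simps)
        then show ?thesis by (simp add: c_def left_diff_distrib)
      qed
      then show ?thesis
        using sums_diff[OF b_sums[OF x] b_sums[OF v(1)], of y y] by (simp add: cdual_apply_diff)
    qed
    ultimately have "x - v \<in> bidual_hull p \<psi>'" by (auto simp: bidual_hull_def)
    then show "\<exists>v\<in>A. x - v \<in> bidual_hull p \<psi>'" using v by blast
  qed (use \<psi>' in auto)
qed

text \<open>Only finitely many points are represented, so the tails of their series are uniformly negligible
  and Helly's theorem moves the remaining finitely many vectors from the bidual into the space.\<close>
lemma bidual_hull_finite_approximation:
  fixes A :: "'a::complex_normed_vector set"
  assumes p: "p \<ge> 1" and \<psi>: "\<psi> \<in> lp p" and A: "finite A" "A \<subseteq> bidual_hull p \<psi>" and \<eta>: "0 < \<eta>"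
  obtains b z and N :: nat where "\<And>n. n < N \<Longrightarrow> norm (z n) \<le> 2 * norm (\<psi> n)"
    and "\<And>v. v \<in> A \<Longrightarrow> b v \<in> dual_ball p"
    and "\<And>v. v \<in> A \<Longrightarrow> norm (v - (\<Sum>n<N. b v n *\<^sub>C z n)) \<le> 2 * \<eta>"
proof -
  have "\<forall>v\<in>A. \<exists>b. b \<in> dual_ball p \<and> (\<forall>y. (\<lambda>n. b n * cdual_apply (\<psi> n) y) sums cdual_apply y v)"
    using A(2) by (auto simp: bidual_hull_def)
  then obtain b where b: "\<And>v. v \<in> A \<Longrightarrow> b v \<in> dual_ball p"
    and b_sums: "\<And>v y. v \<in> A \<Longrightarrow> (\<lambda>n. b v n * cdual_apply (\<psi> n) y) sums cdual_apply y v"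
    by metis
  define tail where "tail = (\<lambda>N n. if n < N then 0 else \<psi> n)"
  have tail_lp: "tail N \<in> lp p" for N
    unfolding tail_def by (rule lp_mono(1)[OF p \<psi>, of _ 1]) auto
  have "(\<lambda>N. lp_norm p (tail N)) \<longlonglongrightarrow> 0" unfolding tail_def by (rule lp_tail_tendsto_0[OF p \<psi>])
  then have "\<forall>\<^sub>F N in sequentially. lp_norm p (tail N) < \<eta>"
    by (rule order_tendstoD) (rule \<eta>)
  then obtain N where N: "lp_norm p (tail N) < \<eta>"
    using eventually_happens trivial_limit_sequentially by blast
  have rest: "cmod (cdual_apply y v - (\<Sum>n<N. b v n * cdual_apply (\<psi> n) y)) \<le> \<eta> * norm y"
    if v: "v \<in> A" for v y
  proof -
    have "(\<lambda>n. if n < N then b v n * cdual_apply (\<psi> n) y else 0) sums (\<Sum>n<N. b v n * cdual_apply (\<psi> n) y)"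
      using sums_finite[of "{..<N}" "\<lambda>n. if n < N then b v n * cdual_apply (\<psi> n) y else 0"] by simp
    from sums_diff[OF b_sums[OF v, of y] this]
    have "(\<lambda>n. b v n * cdual_apply (tail N n) y) sums
        (cdual_apply y v - (\<Sum>n<N. b v n * cdual_apply (\<psi> n) y))"
      by (rule sums_cong[THEN iffD1, rotated]) (simp add: tail_def cdual_apply_simps)
    then have "cmod (cdual_apply y v - (\<Sum>n<N. b v n * cdual_apply (\<psi> n) y)) \<le>
        lp_norm p (\<lambda>n. cdual_apply (tail N n) y)"
      using dual_ball_complex_pairing(2)[OF p b[OF v] lp_norm_functionals(1)[OF p tail_lp[of N], of y]]
      by (simp add: sums_iff)
    also have "\<dots> \<le> norm y * lp_norm p (tail N)" by (rule lp_norm_functionals(2)[OF p tail_lp])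
    also have "\<dots> \<le> norm y * \<eta>" using N by (intro mult_left_mono) auto
    finally show ?thesis by (simp add: mult.commute)
  qed
  obtain z where "\<And>n. n \<in> {..<N} \<Longrightarrow> norm (z n) \<le> 2 * norm (\<psi> n)"
    and "\<And>v. v \<in> A \<Longrightarrow> norm (v - (\<Sum>n<N. b v n *\<^sub>C z n)) \<le> 2 * \<eta>"
  proof (rule helly_approximation[OF A(1) finite_lessThan[of N] norm_ge_zero \<eta>, of "\<lambda>v. v" "\<psi>" b])
    fix y :: "'a \<Rightarrow> 'a cdual"
    let ?Y = "\<lambda>n. \<Sum>v\<in>A. b v n *\<^sub>C y v"
    have "(\<Sum>v\<in>A. cdual_apply (y v) v) = (\<Sum>n<N. cdual_apply (\<psi> n) (?Y n)) +
        (\<Sum>v\<in>A. cdual_apply (y v) v - (\<Sum>n<N. b v n * cdual_apply (\<psi> n) (y v)))"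
      by (simp add: sum_subtractf cdual_apply_simps sum.swap[of _ A])
    also have "cmod \<dots> \<le> (\<Sum>n<N. norm (\<psi> n) * norm (?Y n)) + (\<Sum>v\<in>A. \<eta> * norm (y v))"
      by (intro norm_triangle_le add_mono sum_norm_le cmod_cdual_apply_le rest)
    finally show "cmod (\<Sum>v\<in>A. cdual_apply (y v) v) \<le>
        (\<Sum>n<N. norm (\<psi> n) * norm (?Y n)) + (\<Sum>v\<in>A. \<eta> * norm (y v))" .
  qed blast
  then show thesis by (intro that[of N z b]) (use b in auto)
qed

text \<open>One step of the iteration: every point of the hull is a finite combination of vectors \<open>z\<close> of the
  space, plus a point of a much smaller hull.\<close>
lemma bidual_hull_step:
  fixes \<psi> :: "nat \<Rightarrow> 'a::complex_normed_vector cdual cdual"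
  assumes p: "p \<ge> 1" and \<psi>: "\<psi> \<in> lp p" and \<epsilon>: "0 < \<epsilon>"
  obtains \<psi>' and z :: "nat \<Rightarrow> 'a" and N where "\<psi>' \<in> lp p" "lp_norm p \<psi>' \<le> \<epsilon>"
    and "z \<in> lp p" "lp_norm p z \<le> 4 * lp_norm p \<psi> + \<epsilon>"
    and "\<And>x. x \<in> bidual_hull p \<psi> \<Longrightarrow>
      \<exists>b\<in>dual_ball p. (\<forall>n\<ge>N. b n = 0) \<and> x - (\<Sum>n<N. b n *\<^sub>C z n) \<in> bidual_hull p \<psi>'"
proof -
  obtain A \<psi>' where A: "finite A" "A \<subseteq> bidual_hull p \<psi>" and \<psi>': "\<psi>' \<in> lp p" "lp_norm p \<psi>' \<le> \<epsilon>"
    and cover: "\<And>x. x \<in> bidual_hull p \<psi> \<Longrightarrow> \<exists>v\<in>A. x - v \<in> bidual_hull p \<psi>'"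
    using bidual_hull_finite_cover[OF p \<psi> \<epsilon>] by metis
  define m where "m = card A"
  obtain e where e: "bij_betw e {0..<m} A"
    using ex_bij_betw_nat_finite[OF A(1)] by (auto simp: m_def)
  define \<eta> where "\<eta> = \<epsilon> / (4 * (real m + 1))"
  have \<eta>: "\<eta> > 0" using \<epsilon> by (simp add: \<eta>_def)
  obtain b z0 M where z0: "\<And>n. n < M \<Longrightarrow> norm (z0 n) \<le> 2 * norm (\<psi> n)"
    and b: "\<And>v. v \<in> A \<Longrightarrow> b v \<in> dual_ball p"
    and approx: "\<And>v. v \<in> A \<Longrightarrow> norm (v - (\<Sum>n<M. b v n *\<^sub>C z0 n)) \<le> 2 * \<eta>"
    by (rule bidual_hull_finite_approximation[OF p \<psi> A \<eta>]) blast
  define err where "err = (\<lambda>v. v - (\<Sum>n<M. b v n *\<^sub>C z0 n))"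
  \<comment> \<open>the finitely many errors are appended to the sequence, which makes the representation of \<open>A\<close> exact\<close>
  define z where "z = (\<lambda>n. if n < M then 2 *\<^sub>C z0 n else if n < M + m then 2 *\<^sub>C err (e (n - M)) else 0)"
  have z_lp: "z \<in> lp p" "lp_norm p z \<le> 4 * lp_norm p \<psi> + \<epsilon>"
  proof -
    define h where "h = (\<lambda>n. if n < M then 2 *\<^sub>C z0 n else 0)"
    define t where "t = (\<lambda>n. if M \<le> n \<and> n < M + m then 2 *\<^sub>C err (e (n - M)) else 0)"
    have h: "h \<in> lp p" "lp_norm p h \<le> 4 * lp_norm p \<psi>"
      using lp_mono[OF p \<psi>, of h 4] z0 by (simp_all add: h_def norm_scaleC)
    have t_le: "norm (t n) \<le> \<epsilon> / (real m + 1)" if "n \<in> {M..<M + m}" for n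
    proof -
      have "e (n - M) \<in> A" using e that by (auto simp: bij_betw_def)
      then have "norm (err (e (n - M))) \<le> 2 * \<eta>" using approx by (simp add: err_def)
      then have "norm (t n) \<le> 4 * \<eta>" using that by (simp add: t_def norm_scaleC)
      also have "4 * \<eta> = \<epsilon> / (real m + 1)" by (simp add: \<eta>_def field_simps)
      finally show ?thesis .
    qed
    have t: "t \<in> lp p" "lp_norm p t = (\<Sum>n\<in>{M..<M + m}. norm (t n) powr p) powr (1 / p)"
    proof -
      have "t n = 0" if "n \<notin> {M..<M + m}" for n using that by (auto simp: t_def)
      then show "t \<in> lp p" "lp_norm p t = (\<Sum>n\<in>{M..<M + m}. norm (t n) powr p) powr (1 / p)"
        using lp_finite_support[OF p finite_atLeastLessThan[of M "M + m"], of t] by blast+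
    qed
    have "(\<Sum>n\<in>{M..<M + m}. norm (t n) powr p) \<le> (\<Sum>n\<in>{M..<M + m}. (\<epsilon> / (real m + 1)) powr p)"
      using p t_le by (intro sum_mono powr_mono2) auto
    also have "\<dots> = real m / (real m + 1) powr p * \<epsilon> powr p"
      using \<epsilon> by (simp add: powr_divide)
    also have "\<dots> \<le> 1 * \<epsilon> powr p"
    proof (rule mult_right_mono)
      have "real m \<le> (real m + 1) powr 1" by simp
      also have "\<dots> \<le> (real m + 1) powr p" using p by (intro powr_mono) auto
      finally show "real m / (real m + 1) powr p \<le> 1" by (simp add: field_simps)
    qed simp
    finally have "lp_norm p t \<le> (\<epsilon> powr p) powr (1 / p)"
      unfolding t(2) using p by (intro powr_mono2) (auto intro: sum_nonneg)
    then have "lp_norm p t \<le> \<epsilon>" using p \<epsilon> by (simp add: powr_powr)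
    moreover have "z = h + t" by (auto simp: z_def h_def t_def)
    ultimately show "z \<in> lp p" "lp_norm p z \<le> 4 * lp_norm p \<psi> + \<epsilon>"
      using minkowski_lp[OF p h(1) t(1)] h(2) by auto
  qed
  define b' where "b' = (\<lambda>v n. if n < M then b v n / 2 else if n < M + m \<and> e (n - M) = v then 1 / 2 else 0)"
  have b': "b' v \<in> dual_ball p" "\<forall>n\<ge>M + m. b' v n = 0" "(\<Sum>n<M + m. b' v n *\<^sub>C z n) = v"
    if v: "v \<in> A" for v
  proof -
    obtain i where i: "i < m" "e i = v" using e v by (auto simp: bij_betw_def)
    have uniq: "e j = v \<longleftrightarrow> j = i" if "j < m" for j
      using e i that by (auto simp: bij_betw_def inj_on_def)
    have "(\<lambda>n. if n = M + i then 1 else 0) \<in> dual_ball p"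
      by (rule dual_ball_l1[OF p, of "{M + i}"]) auto
    moreover have "cmod (b' v n) \<le> 1/2 * cmod (b v n) + 1/2 * cmod (if n = M + i then 1 else 0)" for n
      using uniq[of "n - M"] by (auto simp: b'_def norm_divide)
    ultimately show "b' v \<in> dual_ball p"
      using dual_ball_dominated[OF b[OF v], of _ "b' v" "1/2" "1/2"] by simp
    show "\<forall>n\<ge>M + m. b' v n = 0" by (simp add: b'_def)
    have split: "(\<Sum>n<M + m. g n) = (\<Sum>n<M. g n) + (\<Sum>j<m. g (M + j))" for g :: "nat \<Rightarrow> 'a"
      by (induction m) (simp_all add: add.assoc)
    have "(\<Sum>n<M + m. b' v n *\<^sub>C z n) = (\<Sum>n<M. b v n *\<^sub>C z0 n) + (\<Sum>j<m. if j = i then err v else 0)"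
      unfolding split by (intro arg_cong2[of _ _ _ _ "(+)"] sum.cong refl)
        (auto simp: b'_def z_def scaleC_scaleC scaleC_one uniq i)
    then show "(\<Sum>n<M + m. b' v n *\<^sub>C z n) = v"
      using i by (simp add: err_def)
  qed
  show thesis
  proof (rule that[OF \<psi>' z_lp])
    fix x assume "x \<in> bidual_hull p \<psi>"
    then obtain v where "v \<in> A" "x - v \<in> bidual_hull p \<psi>'" using cover by blast
    then show "\<exists>b\<in>dual_ball p. (\<forall>n\<ge>M + m. b n = 0) \<and> x - (\<Sum>n<M + m. b n *\<^sub>C z n) \<in> bidual_hull p \<psi>'"
      using b' by (intro bexI[of _ "b' v"]) auto
  qed
qed

section \<open>Summing the finite pieces\<close>

instance complex_banach \<subseteq> banach ..

text \<open>Since the norms of the blocks \<open>z k\<close> decay like \<open>4\<^bsup>-k\<^esup>\<close>, multiplying the vectors of block \<open>k\<close> by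
  \<open>2\<^bsup>k+1\<^esup>\<close> keeps the whole family \<open>p\<close>-summable, while the compensating factors \<open>2\<^bsup>-k-1\<^esup>\<close> put the glued
  coefficients into the dual ball. These factors also force the coefficients to zero, each block
  being finite, which is what coefficients in \<open>c\<^sub>0\<close> require when \<open>p = 1\<close>.\<close>
lemma dual_ball_series_of_blocks:
  fixes z :: "nat \<Rightarrow> nat \<Rightarrow> 'a::complex_banach"
  assumes p: "p \<ge> 1" and C: "0 \<le> C" and z: "\<And>k. z k \<in> lp p" "\<And>k. lp_norm p (z k) \<le> C / 4 ^ k"
  obtains W where "W \<in> lp p"
    and "\<And>b x. (\<And>k. b k \<in> dual_ball p) \<Longrightarrow> (\<And>k n. N k \<le> n \<Longrightarrow> b k n = 0) \<Longrightarrow>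
      (\<lambda>k. \<Sum>n<N k. b k n *\<^sub>C z k n) sums x \<Longrightarrow> x \<in> p_conv p W"
proof -
  define V where "V = (\<lambda>(k, n). complex_of_real (2 ^ Suc k) *\<^sub>C z k n)"
  have V_sum: "(\<Sum>i\<in>I. norm (V i) powr p) \<le> 2 * (2 * C) powr p" if I: "finite I" for I
  proof -
    define K where "K = fst ` I"
    define J where "J = snd ` I"
    have K: "finite K" "finite J" "I \<subseteq> K \<times> J" using I by (force simp: K_def J_def)+
    have "(\<Sum>i\<in>I. norm (V i) powr p) \<le> (\<Sum>i\<in>K \<times> J. norm (V i) powr p)"
      using K by (intro sum_mono2) auto
    also have "\<dots> = (\<Sum>k\<in>K. \<Sum>n\<in>J. norm (V (k, n)) powr p)" by (simp add: sum.cartesian_product)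
    also have "\<dots> \<le> (\<Sum>k\<in>K. (2 * C) powr p * (1 / 2) ^ k)"
    proof (rule sum_mono)
      fix k
      have "(\<Sum>n\<in>J. norm (V (k, n)) powr p) = (2 ^ Suc k) powr p * (\<Sum>n\<in>J. norm (z k n) powr p)"
        by (simp add: V_def norm_scaleC norm_mult norm_power powr_mult sum_distrib_left)
      also have "\<dots> \<le> (2 ^ Suc k) powr p * lp_norm p (z k) powr p"
        unfolding lp_norm_powr[OF p z(1)] using z(1) K
        by (intro mult_left_mono sum_le_suminf) (auto simp: lp_def)
      also have "\<dots> \<le> (2 ^ Suc k) powr p * (C / 4 ^ k) powr p"
        using p z(2) lp_norm_nonneg by (intro mult_left_mono powr_mono2) auto
      also have "\<dots> = (2 ^ Suc k * (C / 4 ^ k)) powr p" by (simp only: powr_mult)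
      also have "2 ^ Suc k * (C / 4 ^ k) = 2 * C * (1 / 2) ^ k"
      proof -
        have "2 ^ k / 4 ^ k = (1 / 2 :: real) ^ k" using power_divide[of "2::real" 4 k] by simp
        moreover have "2 ^ Suc k * (C / 4 ^ k) = 2 * C * (2 ^ k / 4 ^ k)" by simp
        ultimately show ?thesis by (simp only:)
      qed
      also have "\<dots> powr p = (2 * C) powr p * ((1 / 2) ^ k) powr p" by (rule powr_mult)
      also have "\<dots> \<le> (2 * C) powr p * (1 / 2) ^ k"
      proof (rule mult_left_mono)
        have "((1 / 2) ^ k) powr p \<le> ((1 / 2 :: real) ^ k) powr 1"
          using p by (intro powr_mono') (auto simp: power_le_one)
        then show "((1 / 2) ^ k) powr p \<le> (1 / 2 :: real) ^ k" by simp
      qed simp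
      finally show "(\<Sum>n\<in>J. norm (V (k, n)) powr p) \<le> (2 * C) powr p * (1 / 2) ^ k" .
    qed
    also have "\<dots> = (2 * C) powr p * (\<Sum>k\<in>K. (1 / 2) ^ k)" by (simp add: sum_distrib_left)
    also have "\<dots> \<le> (2 * C) powr p * (\<Sum>k. (1 / 2) ^ k)"
      using K by (intro mult_left_mono sum_le_suminf) (auto intro: summable_geometric)
    also have "(\<Sum>k. (1 / 2 :: real) ^ k) = 2" using suminf_geometric[of "1 / 2 :: real"] by simp
    finally show ?thesis by (simp add: mult.commute)
  qed
  define W where "W = (\<lambda>i. V (prod_decode i))"
  have inj: "inj prod_decode" by (rule inj_prod_decode)
  have "summable (\<lambda>i. norm (W i) powr p)"
  proof (rule summableI_nonneg_bounded)
    fix m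
    show "(\<Sum>i<m. norm (W i) powr p) \<le> 2 * (2 * C) powr p"
      using V_sum[of "prod_decode ` {..<m}"] sum.reindex[OF inj_on_subset[OF inj], of "{..<m}" "\<lambda>i. norm (V i) powr p"]
      by (simp add: W_def o_def)
  qed simp
  then have W: "W \<in> lp p" by (simp add: lp_def)
  show thesis
  proof (rule that[OF W])
    fix b x assume b: "\<And>k. b k \<in> dual_ball p" and supp: "\<And>k n. N k \<le> n \<Longrightarrow> b k n = 0"
      and x: "(\<lambda>k. \<Sum>n<N k. b k n *\<^sub>C z k n) sums x"
    have b_le: "cmod (b k n) \<le> 1" for k n
      using dual_ballD[OF b, of "{n}" "\<lambda>_. 1" k] by simp
    define a where "a = (\<lambda>(k, n). complex_of_real ((1 / 2) ^ Suc k) * b k n)"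
    define a' where "a' = (\<lambda>i. a (prod_decode i))"
    have "a \<in> dual_ball p"
      unfolding a_def
    proof (rule dual_ball_blocks[OF p b])
      show "(\<Sum>k\<in>K. (1 / 2 :: real) ^ Suc k) \<le> 1" if "finite K" for K
        using sum_le_suminf[of "\<lambda>k. (1 / 2 :: real) ^ Suc k" K] power_half_series that
        by (simp add: sums_iff)
    qed simp
    then have a': "a' \<in> dual_ball p" unfolding a'_def by (rule dual_ball_reindex[OF _ inj])
    have "a' \<longlonglongrightarrow> 0"
    proof (rule tendstoI)
      fix r :: real assume "r > 0"
      then obtain K where K: "(1 / 2 :: real) ^ K < r" using real_arch_pow_inv[of r "1/2"] by auto
      have "{i. \<not> dist (a' i) 0 < r} \<subseteq> prod_encode ` (SIGMA k:{..<K}. {..<N k})"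
      proof
        fix i assume i: "i \<in> {i. \<not> dist (a' i) 0 < r}"
        obtain k n where kn: "prod_decode i = (k, n)" by fastforce
        have ge: "r \<le> (1 / 2) ^ Suc k * cmod (b k n)"
          using i kn by (simp add: a'_def a_def norm_mult norm_power norm_divide)
        then have "n < N k" using supp[of k n] \<open>r > 0\<close> by (cases "n < N k") auto
        moreover have "k < K"
        proof (rule ccontr)
          assume "\<not> k < K"
          then have "(1 / 2 :: real) ^ Suc k \<le> (1 / 2) ^ K" by (intro power_decreasing) auto
          moreover have "(1 / 2 :: real) ^ Suc k * cmod (b k n) \<le> (1 / 2) ^ Suc k"
            by (rule mult_left_le[OF b_le]) simp
          ultimately show False using ge K by linarith
        qed
        ultimately have "prod_encode (k, n) \<in> prod_encode ` (SIGMA k:{..<K}. {..<N k})" by blast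
        then show "i \<in> prod_encode ` (SIGMA k:{..<K}. {..<N k})"
          using kn by (metis prod_decode_inverse)
      qed
      then have "finite {i. \<not> dist (a' i) 0 < r}" by (rule finite_subset) auto
      then show "\<forall>\<^sub>F i in sequentially. dist (a' i) 0 < r"
        unfolding cofinite_eq_sequentially[symmetric] eventually_cofinite .
    qed
    then have coeff: "a' \<in> coeff_ball p" by (rule null_dual_ball_subset_coeff_ball[OF p a'])
    let ?f = "\<lambda>i. a' i *\<^sub>C W i"
    have norm_f: "summable (\<lambda>i. norm (?f i))"
      using dual_ball_pairing(1)[OF p a' W] by (simp add: norm_scaleC)
    define S where "S = suminf ?f"
    have S: "?f sums S" unfolding S_def by (rule summable_sums[OF summable_norm_cancel[OF norm_f]])
    have "(?f has_sum S) UNIV" by (rule norm_summable_imp_has_sum[OF norm_f S])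
    then have "((\<lambda>i. a i *\<^sub>C V i) has_sum S) UNIV"
      unfolding a'_def W_def
      by (subst (asm) has_sum_reindex_bij_betw[OF bij_prod_decode, of "\<lambda>i. a i *\<^sub>C V i"])
    then have "((\<lambda>i. a i *\<^sub>C V i) has_sum S) (UNIV \<times> UNIV)" by simp
    then have "((\<lambda>k. \<Sum>n<N k. b k n *\<^sub>C z k n) has_sum S) UNIV"
    proof (rule has_sum_SigmaD)
      fix k
      define r s where "r = complex_of_real ((1 / 2) ^ Suc k)" and "s = complex_of_real (2 ^ Suc k)"
      have "(1 / 2 :: real) ^ Suc k * 2 ^ Suc k = 1"
        by (simp only: power_mult_distrib[symmetric]) simp
      then have rs: "r * s = 1" unfolding r_def s_def by (simp only: of_real_mult[symmetric] of_real_1)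
      have "a (k, n) *\<^sub>C V (k, n) = b k n *\<^sub>C z k n" for n
      proof -
        have "a (k, n) *\<^sub>C V (k, n) = (r * b k n * s) *\<^sub>C z k n"
          by (simp only: a_def V_def r_def s_def prod.case scaleC_scaleC)
        also have "r * b k n * s = b k n * (r * s)" by (simp only: mult_ac)
        finally show ?thesis by (simp only: rs mult_1_right)
      qed
      moreover have "((\<lambda>n. b k n *\<^sub>C z k n) has_sum (\<Sum>n<N k. b k n *\<^sub>C z k n)) UNIV"
        by (rule has_sum_finite_neutralI[of "{..<N k}"]) (use supp[of k] in auto)
      ultimately show "((\<lambda>n. a (k, n) *\<^sub>C V (k, n)) has_sum (\<Sum>n<N k. b k n *\<^sub>C z k n)) UNIV"
        by (simp only:)
    qed
    then have "S = x" using x by (intro sums_unique2[OF has_sum_imp_sums])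
    then show "x \<in> p_conv p W" using S coeff by (auto simp: p_conv_def)
  qed
qed

text \<open>Iterating the step with hulls of norm \<open>C / 4\<^bsup>k\<^esup>\<close> expands every point into a series of finite blocks;
  the remainders tend to zero since a point of a hull has at most the norm of the sequence.\<close>
lemma bidual_hull_relatively_p_compact:
  fixes \<psi> :: "nat \<Rightarrow> 'a::complex_banach cdual cdual"
  assumes p: "p \<ge> 1" and \<psi>: "\<psi> \<in> lp p"
  shows "relatively_p_compact p (bidual_hull p \<psi>)"
proof -
  define C where "C = lp_norm p \<psi> + 1"
  have C: "C > 0" using lp_norm_nonneg[of p \<psi>] by (simp add: C_def)
  define Q where "Q = (\<lambda>k \<psi> \<psi>' (z :: nat \<Rightarrow> 'a) N. z \<in> lp p \<and> lp_norm p z \<le> 5 * C / 4 ^ k \<and>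
      (\<forall>x\<in>bidual_hull p \<psi>. \<exists>b\<in>dual_ball p. (\<forall>n\<ge>N. b n = 0) \<and>
        x - (\<Sum>n<N. b n *\<^sub>C z n) \<in> bidual_hull p \<psi>'))"
  have "\<exists>\<Psi>. \<forall>k. (\<Psi> k \<in> lp p \<and> lp_norm p (\<Psi> k) \<le> C / 4 ^ k \<and> (k = 0 \<longrightarrow> \<Psi> k = \<psi>)) \<and>
      (\<exists>z N. Q k (\<Psi> k) (\<Psi> (Suc k)) z N)"
  proof (rule dependent_nat_choice)
    show "\<exists>\<phi>. \<phi> \<in> lp p \<and> lp_norm p \<phi> \<le> C / 4 ^ 0 \<and> (0 = 0 \<longrightarrow> \<phi> = \<psi>)"
      using \<psi> by (simp add: C_def)
    fix \<phi> and k :: nat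
    assume \<phi>: "\<phi> \<in> lp p \<and> lp_norm p \<phi> \<le> C / 4 ^ k \<and> (k = 0 \<longrightarrow> \<phi> = \<psi>)"
    have e: "0 < C / 4 ^ Suc k" using C by simp
    obtain \<phi>' z N where *: "\<phi>' \<in> lp p" "lp_norm p \<phi>' \<le> C / 4 ^ Suc k" "z \<in> lp p"
      "lp_norm p z \<le> 4 * lp_norm p \<phi> + C / 4 ^ Suc k"
      "\<And>x. x \<in> bidual_hull p \<phi> \<Longrightarrow>
        \<exists>b\<in>dual_ball p. (\<forall>n\<ge>N. b n = 0) \<and> x - (\<Sum>n<N. b n *\<^sub>C z n) \<in> bidual_hull p \<phi>'"
      by (rule bidual_hull_step[OF p conjunct1[OF \<phi>] e]) (rule that)
    have "lp_norm p z \<le> 4 * (C / 4 ^ k) + C / 4 ^ k"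
      using *(4) \<phi> C by (intro order_trans[OF *(4)] add_mono mult_left_mono) (auto simp: field_simps)
    then have "Q k \<phi> \<phi>' z N" using * by (auto simp: Q_def)
    then show "\<exists>\<phi>'. (\<phi>' \<in> lp p \<and> lp_norm p \<phi>' \<le> C / 4 ^ Suc k \<and> (Suc k = 0 \<longrightarrow> \<phi>' = \<psi>)) \<and>
        (\<exists>z N. Q k \<phi> \<phi>' z N)"
      using * by blast
  qed
  then obtain \<Psi> where \<Psi>: "\<And>k. \<Psi> k \<in> lp p" "\<And>k. lp_norm p (\<Psi> k) \<le> C / 4 ^ k" "\<Psi> 0 = \<psi>"
    and ex: "\<And>k. \<exists>z N. Q k (\<Psi> k) (\<Psi> (Suc k)) z N" by blast
  from ex have "\<exists>z. \<forall>k. \<exists>N. Q k (\<Psi> k) (\<Psi> (Suc k)) (z k) N" by (intro choice allI)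
  then obtain z where "\<forall>k. \<exists>N. Q k (\<Psi> k) (\<Psi> (Suc k)) (z k) N" by blast
  then obtain N where Q: "\<And>k. Q k (\<Psi> k) (\<Psi> (Suc k)) (z k) (N k)" using choice[of "\<lambda>k. Q k (\<Psi> k) (\<Psi> (Suc k)) (z k)"] by blast
  obtain W where W: "W \<in> lp p" and conv: "\<And>b x. (\<And>k. b k \<in> dual_ball p) \<Longrightarrow>
      (\<And>k n. N k \<le> n \<Longrightarrow> b k n = 0) \<Longrightarrow>
      (\<lambda>k. \<Sum>n<N k. b k n *\<^sub>C z k n) sums x \<Longrightarrow> x \<in> p_conv p W"
    by (rule dual_ball_series_of_blocks[OF p, of "5 * C" z N]) (use C Q in \<open>auto simp: Q_def\<close>)
  have "x \<in> p_conv p W" if x: "x \<in> bidual_hull p \<psi>" for x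
  proof -
    define P where "P = (\<lambda>k y y' b. b \<in> dual_ball p \<and> (\<forall>n\<ge>N k. b n = 0) \<and>
        y' = y - (\<Sum>n<N k. b n *\<^sub>C z k n))"
    have "\<exists>xs. \<forall>k. (xs k \<in> bidual_hull p (\<Psi> k) \<and> (k = 0 \<longrightarrow> xs k = x)) \<and> (\<exists>b. P k (xs k) (xs (Suc k)) b)"
    proof (rule dependent_nat_choice)
      show "\<exists>y. y \<in> bidual_hull p (\<Psi> 0) \<and> (0 = 0 \<longrightarrow> y = x)" using x \<Psi> by simp
      show "\<exists>y'. (y' \<in> bidual_hull p (\<Psi> (Suc k)) \<and> (Suc k = 0 \<longrightarrow> y' = x)) \<and> (\<exists>b. P k y y' b)"
        if "y \<in> bidual_hull p (\<Psi> k) \<and> (k = 0 \<longrightarrow> y = x)" for y k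
        using that Q[of k] unfolding Q_def P_def by blast
    qed
    then obtain xs where xs: "\<And>k. xs k \<in> bidual_hull p (\<Psi> k)" "xs 0 = x"
      and "\<forall>k. \<exists>b. P k (xs k) (xs (Suc k)) b" by metis
    then obtain b where b: "\<And>k. P k (xs k) (xs (Suc k)) (b k)" by metis
    have partial: "(\<Sum>k<m. \<Sum>n<N k. b k n *\<^sub>C z k n) = x - xs m" for m
    proof (induction m)
      case 0
      then show ?case using xs by simp
    next
      case (Suc m)
      then show ?case using b[of m] by (simp add: P_def)
    qed
    have "xs \<longlonglongrightarrow> 0"
    proof (rule Lim_null_comparison)
      show "\<forall>\<^sub>F k in sequentially. norm (xs k) \<le> C * (1 / 4) ^ k"
        using order_trans[OF bidual_hull_norm_le[OF p \<Psi>(1) xs(1)] \<Psi>(2)]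
        by (intro always_eventually allI) (simp add: power_one_over)
      show "(\<lambda>k. C * (1 / 4) ^ k) \<longlonglongrightarrow> 0"
        by (intro tendsto_mult_right_zero LIMSEQ_power_zero) simp
    qed
    from tendsto_diff[OF tendsto_const[of x] this]
    have "(\<lambda>k. \<Sum>n<N k. b k n *\<^sub>C z k n) sums x" by (simp add: sums_def partial)
    then show ?thesis using b by (intro conv[of b]) (auto simp: P_def)
  qed
  then show ?thesis using W by (auto simp: relatively_p_compact_def)
qed

text \<open>Quasi \<open>p\<close>-nuclearity of \<open>R\<close> and boundedness of \<open>S\<close> give
  \<open>|y(f u)| \<le> K (\<Sum> |\<phi>\<^sub>n(y)|\<^bsup>p\<^esup>)\<^bsup>1/p\<^esup>\<close>, which places the range of \<open>f\<close> in a bidual hull.\<close>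
lemma p_compact_range_if_transpose_factors:
  fixes U :: "'e::complex_banach set" and f :: "'e \<Rightarrow> 'f::complex_banach"
    and M :: "(nat \<Rightarrow> complex) set"
  assumes p: "1 \<le> p" and R: "R \<in> quasi_p_nuclear_ops p M (lp_norm p)"
    and S: "S \<in> bounded_ops M (lp_norm p) (Hinf U) (Hinf_norm U)"
    and SR: "holo_transpose f = S \<circ> R"
  shows "relatively_p_compact p (f ` U)"
proof -
  have R': "R \<in> bounded_ops UNIV norm M (lp_norm p)" and
    "\<exists>\<phi>\<in>lp p. \<forall>y. lp_norm p (R y) \<le> (\<Sum>n. cmod (cdual_apply (\<phi> n) y) powr p) powr (1 / p)"
    using R unfolding quasi_p_nuclear_ops_def mem_Collect_eq by (rule conjunct1, rule conjunct2)
  then obtain \<phi> where \<phi>: "\<phi> \<in> lp p"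
    and R_le: "\<And>y. lp_norm p (R y) \<le> lp_norm p (\<lambda>n. cdual_apply (\<phi> n) y)"
    unfolding lp_norm_def[of p "\<lambda>n. cdual_apply (_ n) _"] by blast
  have "R ` UNIV \<subseteq> M"
    using R' unfolding bounded_ops_def mem_Collect_eq by (elim conjE)
  then have RM: "R y \<in> M" for y by (rule subsetD) (rule rangeI)
  have ex: "\<exists>K. \<forall>m\<in>M. Hinf_norm U (S m) \<le> K * lp_norm p m"
    using S unfolding bounded_ops_def mem_Collect_eq by (elim conjE)
  have "S ` M \<subseteq> Hinf U"
    using S unfolding bounded_ops_def mem_Collect_eq by (elim conjE)
  then have S_Hinf: "S m \<in> Hinf U" if "m \<in> M" for m
    by (rule subsetD) (rule imageI[OF that])
  obtain K where K: "\<And>m. m \<in> M \<Longrightarrow> Hinf_norm U (S m) \<le> K * lp_norm p m"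
    using ex by (elim exE) (rule that, erule bspec)
  define \<psi> where "\<psi> = complex_of_real \<bar>K\<bar> *\<^sub>C \<phi>"
  have \<psi>: "\<psi> \<in> lp p" unfolding \<psi>_def by (rule lp_scaleC(1)[OF p \<phi>])
  have "f u \<in> bidual_hull p \<psi>" if u: "u \<in> U" for u
  proof (rule bidual_hull_if_dominated[OF p \<psi>])
    fix y
    have "S (R y) \<in> Hinf U" by (rule S_Hinf[OF RM])
    have "cdual_apply y (f u) = S (R y) u"
      using fun_cong[OF fun_cong[OF SR, of y], of u] by (simp add: holo_transpose_def)
    also have "cmod \<dots> \<le> Hinf_norm U (S (R y))" by (rule norm_le_Hinf_norm) fact+
    also have "\<dots> \<le> K * lp_norm p (R y)" by (rule K[OF RM])
    also have "\<dots> \<le> \<bar>K\<bar> * lp_norm p (R y)" by (intro mult_right_mono lp_norm_nonneg) simp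
    also have "\<dots> \<le> \<bar>K\<bar> * lp_norm p (\<lambda>n. cdual_apply (\<phi> n) y)" by (intro mult_left_mono R_le) simp
    also have "\<dots> = lp_norm p (\<lambda>n. cdual_apply (\<psi> n) y)"
    proof -
      have "(\<lambda>n. cdual_apply (\<psi> n) y) = complex_of_real \<bar>K\<bar> *\<^sub>C (\<lambda>n. cdual_apply (\<phi> n) y)"
        by (simp add: \<psi>_def fun_eq_iff scaleC_fun_def scaleC_complex_def scaleC_cdual.rep_eq)
      then show ?thesis by (simp only: lp_scaleC(2)[OF p lp_norm_functionals(1)[OF p \<phi>]]) simp
    qed
    finally show "cmod (cdual_apply y (f u)) \<le> lp_norm p (\<lambda>n. cdual_apply (\<psi> n) y)" .
  qed
  then show ?thesis
    using bidual_hull_relatively_p_compact[OF p \<psi>] unfolding relatively_p_compact_def by blast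
qed

theorem corollary1p9:
  fixes U :: "'e::complex_banach set"
    and f :: "'e \<Rightarrow> 'f::complex_banach"
    and p :: real
  assumes "open U"
    and "1 \<le> p"
    and "f \<in> Hinf U"
  shows "relatively_p_compact p (f ` U) \<longleftrightarrow>
    (\<exists>(M :: (nat \<Rightarrow> complex) set) R S.
       complex_vector.subspace M \<and> closedin (lp_topology p) M \<and>
       R \<in> quasi_p_nuclear_ops p M (lp_norm p) \<and>
       S \<in> bounded_ops M (lp_norm p) (Hinf U) (Hinf_norm U) \<and>
       holo_transpose f = S \<circ> R)"
proof
  assume "relatively_p_compact p (f ` U)"
  with assms show "\<exists>(M :: (nat \<Rightarrow> complex) set) R S.
       complex_vector.subspace M \<and> closedin (lp_topology p) M \<and>
       R \<in> quasi_p_nuclear_ops p M (lp_norm p) \<and>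
       S \<in> bounded_ops M (lp_norm p) (Hinf U) (Hinf_norm U) \<and>
       holo_transpose f = S \<circ> R"
    by (rule transpose_factors_if_p_compact_range)
qed (elim exE conjE, rule p_compact_range_if_transpose_factors[OF assms(2)])

end
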